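(* Let $P$ be a convex simplicial 3-polytope inscribed in $\mathbb{S}^2$, with $o\in\operatorname{int}(P)$. Let $v$ be a vertex of $P$ of degree $m$, and let $F_1,\dots,F_m$ be the triangular facets incident with $v$, ordered cyclically around $v$. Set $$\alpha_v:=\sum_{i=1}^m\operatorname{area}(R(F_i)).$$ Then $$\sum_{i=1}^m\operatorname{vol}([o,F_i])\le\Psi_m(\alpha_v),$$ where $$\Psi_m(\alpha):=\frac m3\left(\cot\frac{\pi}{m}\right)\frac{\sin^2(\pi/m)-\sin^2\left(\frac{2\pi-\alpha}{2m}\right)}{\cos^2\left(\frac{2\pi-\alpha}{2m}\right)}.$$
   Context: $\mathbb{S}^2$ is the unit sphere in $\mathbb{R}^3$ and $o$ is the origin. A polytope is inscribed in $\mathbb{S}^2$ if all its vertices lie on $\mathbb{S}^2$. $R(x)=x/\|x\|$ is the radial projection onto $\mathbb{S}^2$, and $\operatorname{area}$ is spherical surface area. $[o,F]:=\operatorname{conv}(\{o\}\cup F)$ is the facial cone over a facet $F$, and $\operatorname{vol}$ is 3-dimensional volume. *)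

theory Defs
  imports "HOL-Analysis.Analysis"
begin

definition simplicial_polytope :: "'a::euclidean_space set \<Rightarrow> bool" where
  "simplicial_polytope P \<longleftrightarrow> polytope P \<and> (\<forall>F. F facet_of P \<longrightarrow> (aff_dim F) simplex F)"

definition inscribed_in_unit_sphere :: "'a::euclidean_space set \<Rightarrow> bool" where
  "inscribed_in_unit_sphere P \<longleftrightarrow> {v. v extreme_point_of P} \<subseteq> sphere 0 1"

definition vertex_degree :: "'a::euclidean_space set \<Rightarrow> 'a \<Rightarrow> nat" where
  "vertex_degree P v = card {e. e edge_of P \<and> v \<in> e}"

text \<open>The labels are \<open>1, \<dots>, m\<close>, and \<open>i mod m + 1\<close> is the cyclic successor of \<open>i\<close>.\<close>

definition cyclic_facets_at ::
    "'a::euclidean_space set \<Rightarrow> 'a \<Rightarrow> nat \<Rightarrow> (nat \<Rightarrow> 'a set) \<Rightarrow> bool" where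
  "cyclic_facets_at P v m F \<longleftrightarrow>
     bij_betw F {1..m} {G. G facet_of P \<and> v \<in> G} \<and>
     (\<forall>i\<in>{1..m}. (F i \<inter> F (i mod m + 1)) edge_of P)"

definition radial_projection :: "'a::euclidean_space \<Rightarrow> 'a" where
  "radial_projection x = x /\<^sub>R norm x"

definition facial_cone :: "'a::euclidean_space set \<Rightarrow> 'a set" where
  "facial_cone F = convex hull ({0} \<union> F)"

text \<open>Surface area on the unit sphere, defined by \<open>dim\<close> times the volume of the solid sector
  that \<open>A\<close> spans with the centre. On three-dimensional space this is the usual surface area: it is
  rotation invariant and gives the whole sphere area \<open>4 * pi\<close>, as the two lemmas below show.\<close>

definition solid_sector :: "'a::euclidean_space set \<Rightarrow> 'a set" where
  "solid_sector A = {t *\<^sub>R x | t x. 0 \<le> t \<and> t \<le> 1 \<and> x \<in> A}"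

definition sphere_area :: "'a::euclidean_space set \<Rightarrow> real" where
  "sphere_area A = real DIM('a) * measure lebesgue (solid_sector A)"

lemma sphere_area_sphere: "sphere_area (sphere (0::real^3) 1) = 4 * pi"
proof -
  have "x \<in> solid_sector (sphere (0::real^3) 1)" if "norm x \<le> 1" for x :: "real^3"
  proof (cases "x = 0")
    case True
    have "axis 1 1 \<in> sphere (0::real^3) 1" by simp
    moreover have "x = 0 *\<^sub>R (axis 1 1 :: real^3)" using True by simp
    ultimately show ?thesis unfolding solid_sector_def mem_Collect_eq
      by (intro exI[of _ 0] exI[of _ "axis 1 1"]) simp
  next
    case False
    then have "x = norm x *\<^sub>R sgn x" "sgn x \<in> sphere 0 1"
      by (simp_all add: sgn_div_norm)
    then show ?thesis unfolding solid_sector_def mem_Collect_eq using that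
      by (intro exI[of _ "norm x"] exI[of _ "sgn x"]) simp
  qed
  then have "solid_sector (sphere (0::real^3) 1) = cball 0 1"
    by (auto simp: solid_sector_def)
  then show ?thesis
    by (simp add: sphere_area_def content_cball unit_ball_vol_3)
qed

lemma sphere_area_orthogonal_image:
  fixes f :: "real^3 \<Rightarrow> real^3"
  assumes "orthogonal_transformation f" "solid_sector A \<in> lmeasurable"
  shows "sphere_area (f ` A) = sphere_area A"
proof -
  have "linear f" using assms by (simp add: orthogonal_transformation_linear)
  then have scale: "f (t *\<^sub>R x) = t *\<^sub>R f x" for t x by (rule linear_scale)
  have *: "solid_sector B = (\<Union>t\<in>{0..1}. (*\<^sub>R) t ` B)" for B :: "(real^3) set"
    unfolding solid_sector_def set_eq_iff mem_Collect_eq UN_iff image_iff atLeastAtMost_iff Bex_def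
    by blast
  have "solid_sector (f ` A) = f ` solid_sector A"
    by (simp add: * image_UN image_image scale)
  then show ?thesis
    using assms by (simp add: sphere_area_def measure_orthogonal_image)
qed

definition Psi :: "nat \<Rightarrow> real \<Rightarrow> real" where
  "Psi m \<alpha> = real m / 3 * cot (pi / real m) *
     (((sin (pi / real m))\<^sup>2 - (sin ((2 * pi - \<alpha>) / (2 * real m)))\<^sup>2) /
      (cos ((2 * pi - \<alpha>) / (2 * real m)))\<^sup>2)"

end

theory Submission
  imports Defs
begin

text \<open>For a facet \<open>conv {v, w, u}\<close> let \<open>2 h\<close> be the angle at \<open>v\<close> of its spherical triangle, let
  \<open>\<psi>\<close> and \<open>\<omega>\<close> be the other two angles, and put \<open>x = (pi - \<psi> - \<omega>) / 2\<close>, so that by Girard's theorem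
  the area is \<open>2 h - 2 x\<close>.  For fixed \<open>h\<close> and \<open>x\<close> the volume of the facial cone is largest when
  \<open>\<psi> = \<omega>\<close>, and it is then one third of \<open>sin h cos h - (cos\<^sup>3 h / sin h) tan\<^sup>2 x\<close>, which is jointly
  concave in \<open>(h, x)\<close>.  The wedges that the facets at \<open>v\<close> span with the line through \<open>v\<close> tile space,
  so the angles at \<open>v\<close> add up to \<open>2 pi\<close>, and Jensen's inequality gives the bound.\<close>

section \<open>The extremal volume as a concave function\<close>

text \<open>The angle at \<open>v\<close> varies from facet to facet and only its sum is known, so
  Jensen's inequality has to act on the pairs (h, x), not on the areas alone. The sums of h and x
  are pi and (2 * pi - \<alpha>) / 2, where \<alpha> is the total area. The mean over the m facets
  is therefore (pi / m, (2 * pi - \<alpha>) / (2 * m)), and \<open>Psi m \<alpha>\<close> is m / 3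
  times \<open>vol_bound\<close> at this mean. Girard's formula and the angle sum are both read off
  from volumes: a wedge of dihedral angle 2 h cuts 4 h / 3 out of the unit ball, and spherical area
  is itself three times the volume of a sector. The spherical triangles at \<open>v\<close> cover
  only part of the sphere; extending them to wedges turns the angle sum into the volume of the whole
  ball.\<close>

definition vol_bound :: "real \<Rightarrow> real \<Rightarrow> real" where
  "vol_bound h x = sin h * cos h - cos h ^ 3 / sin h * (tan x)\<^sup>2"

text \<open>This is the shape in which the bound occurs in \<open>Psi\<close>. The definition
  instead keeps h and x in separate factors, which suits differentiation.\<close>

lemma vol_bound_alt:
  assumes "sin h \<noteq> 0" "cos x \<noteq> 0"
  shows "vol_bound h x = cot h * (((sin h)\<^sup>2 - (sin x)\<^sup>2) / (cos x)\<^sup>2)"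
proof -
  have "(sin h)\<^sup>2 * (cos x)\<^sup>2 - (cos h)\<^sup>2 * (sin x)\<^sup>2 = (sin h)\<^sup>2 - (sin x)\<^sup>2"
    unfolding sin_squared_eq by (simp add: algebra_simps)
  moreover have "vol_bound h x =
      cot h * (((sin h)\<^sup>2 * (cos x)\<^sup>2 - (cos h)\<^sup>2 * (sin x)\<^sup>2) / (cos x)\<^sup>2)"
    using assms by (simp add: vol_bound_def cot_def tan_def field_simps power2_eq_square power3_eq_cube)
  ultimately show ?thesis by simp
qed

text \<open>With \<open>S = sin\<^sup>2 h\<close> and \<open>T = tan\<^sup>2 x\<close>, the determinant of the Hessian is
  a positive multiple of the perfect square \<open>(T - S * (1 + T))\<^sup>2\<close>.\<close>

lemma vol_bound_second_derivative_le_0: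
  fixes s c \<tau> p q :: real
  assumes sc: "s\<^sup>2 + c\<^sup>2 = 1" and pos: "0 < s" "0 < c"
  defines "T \<equiv> \<tau>\<^sup>2"
  shows "0 \<le> (2 * c / s ^ 3 + 4 * s * c) * T * p\<^sup>2 + 4 * s * c * p\<^sup>2
    - 2 * (c\<^sup>2 * (1 + 2 * s\<^sup>2) / s\<^sup>2) * (2 * \<tau> * (1 + T)) * p * q
    + (c ^ 3 / s) * (2 * (1 + T) * (1 + 3 * T)) * q\<^sup>2"
proof -
  define S where "S = s\<^sup>2"
  \<comment> \<open>Half the Hessian entries that remain after the positive factor 2 * c / s ^ 3 is
    taken out up to a factor: the target is exactly that factor times A * p^2 - 2 * B * p * q + E *
    q^2.\<close>
  define A B E where "A = T * (1 + 2 * S\<^sup>2) + 2 * S\<^sup>2"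
    and "B = c * s * (1 + 2 * S) * \<tau> * (1 + T)" and "E = c\<^sup>2 * S * (1 + T) * (1 + 3 * T)"
  have T: "0 \<le> T" by (simp add: T_def)
  have S: "0 < S" using pos by (simp add: S_def)
  have A: "0 < A" using T S by (simp add: A_def add_nonneg_pos)
  have "A * E - B\<^sup>2 = c\<^sup>2 * S * (1 + T) * (A * (1 + 3 * T) - (1 + 2 * S)\<^sup>2 * T * (1 + T))"
    by (simp add: B_def E_def S_def T_def algebra_simps power2_eq_square)
  also have "A * (1 + 3 * T) - (1 + 2 * S)\<^sup>2 * T * (1 + T) = 2 * (T - S * (1 + T))\<^sup>2"
    by (simp add: A_def algebra_simps power2_eq_square)
  finally have AE: "0 \<le> A * E - B\<^sup>2" using T S by simp
  have "0 \<le> (A * p - B * q)\<^sup>2 + (A * E - B\<^sup>2) * q\<^sup>2" using AE by simp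
  also have "\<dots> = A * (A * p\<^sup>2 - 2 * B * p * q + E * q\<^sup>2)"
    by (simp add: algebra_simps power2_eq_square)
  finally have "0 \<le> A * p\<^sup>2 - 2 * B * p * q + E * q\<^sup>2" using A by (simp add: zero_le_mult_iff)
  then have "0 \<le> 2 * c / s ^ 3 * (A * p\<^sup>2 - 2 * B * p * q + E * q\<^sup>2)"
    using pos by (intro mult_nonneg_nonneg) auto
  also have "\<dots> = (2 * c / s ^ 3 + 4 * s * c) * T * p\<^sup>2 + 4 * s * c * p\<^sup>2
    - 2 * (c\<^sup>2 * (1 + 2 * s\<^sup>2) / s\<^sup>2) * (2 * \<tau> * (1 + T)) * p * q
    + (c ^ 3 / s) * (2 * (1 + T) * (1 + 3 * T)) * q\<^sup>2"
    using pos by (simp add: A_def B_def E_def S_def field_simps power2_eq_square power3_eq_cube)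
  finally show ?thesis .
qed

text \<open>Negative x must be allowed, because the two angles away from \<open>v\<close> can add up
  to more than pi: for the regular tetrahedron x is - pi / 6.\<close>

definition angle_domain :: "(real \<times> real) set" where
  "angle_domain = {0<..<pi/2} \<times> {-pi/2<..<pi/2}"

text \<open>Concavity on a convex set can be tested on segments. Along a segment of direction (p, q)
  the second derivative is minus the quadratic form of the preceding lemma, so one-variable calculus
  suffices.\<close>

lemma concave_vol_bound: "concave_on angle_domain (\<lambda>(h, x). vol_bound h x)"
proof -
  have *: "concave_on {0..1} (\<lambda>t. vol_bound (h + t * p) (x + t * q))"
    if dom: "\<And>t. t \<in> {0..1} \<Longrightarrow> h + t * p \<in> {0<..<pi/2} \<and> x + t * q \<in> {-pi/2<..<pi/2}"
    for h x p q :: real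
  proof -
    define s c \<tau> where "s t = sin (h + t * p)" and "c t = cos (h + t * p)"
      and "\<tau> t = tan (x + t * q)" for t
    have pos: "0 < s t" "0 < c t" "cos (x + t * q) \<noteq> 0" if "t \<in> {0..1}" for t
    proof -
      have *: "h + t * p \<in> {0<..<pi/2}" "x + t * q \<in> {-pi/2<..<pi/2}" using dom[OF that] by auto
      show "0 < s t" using * by (auto simp: s_def intro!: sin_gt_zero)
      show "0 < c t" using * by (auto simp: c_def intro!: cos_gt_zero)
      show "cos (x + t * q) \<noteq> 0" using * cos_gt_zero_pi[of "x + t * q"] by auto
    qed
    have ds: "(s has_real_derivative c t * p) (at t)" for t
      unfolding s_def c_def by (auto intro!: derivative_eq_intros)
    have dc: "(c has_real_derivative - s t * p) (at t)" for t
      unfolding s_def c_def by (auto intro!: derivative_eq_intros)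
    have dt: "(\<tau> has_real_derivative (1 + (\<tau> t)\<^sup>2) * q) (at t)" if "t \<in> {0..1}" for t
    proof -
      have "1 + (\<tau> t)\<^sup>2 = inverse ((cos (x + t * q))\<^sup>2)"
        using tan_sec[OF pos(3)[OF that]] by (simp add: \<tau>_def power_inverse)
      then show ?thesis
        unfolding \<tau>_def using pos(3)[OF that] by (auto intro!: derivative_eq_intros)
    qed
    have sc: "(s t)\<^sup>2 + (c t)\<^sup>2 = 1" for t by (simp add: s_def c_def)
    \<comment> \<open>\<open>u\<close> is the coefficient of tan^2 x, \<open>u1\<close> is minus its
      derivative in h, and \<open>w1\<close> is the derivative of tan^2 x in x.\<close>
    define u u1 w1 where "u t = c t ^ 3 / s t" and "u1 t = (c t)\<^sup>2 * (1 + 2 * (s t)\<^sup>2) / (s t)\<^sup>2"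
      and "w1 t = 2 * \<tau> t * (1 + (\<tau> t)\<^sup>2)" for t
    have dsc: "((\<lambda>t. s t * c t) has_real_derivative (1 - 2 * (s t)\<^sup>2) * p) (at t)" for t
    proof -
      have "c t * p * c t + - s t * p * s t = ((s t)\<^sup>2 + (c t)\<^sup>2 - 2 * (s t)\<^sup>2) * p"
        by (simp add: algebra_simps power2_eq_square)
      then have e: "c t * p * c t + - s t * p * s t = (1 - 2 * (s t)\<^sup>2) * p" unfolding sc .
      show ?thesis using DERIV_mult[OF ds dc, of t] unfolding e .
    qed
    have ds2: "((\<lambda>t. (1 - 2 * (s t)\<^sup>2) * p) has_real_derivative - (4 * s t * c t * p\<^sup>2)) (at t)" for t
      by (rule derivative_eq_intros ds refl)+ (simp add: algebra_simps power2_eq_square)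
    have du: "(u has_real_derivative - u1 t * p) (at t)" if "t \<in> {0..1}" for t
    proof -
      have "(3 * (c t)\<^sup>2 * (- s t * p) * s t - c t ^ 3 * (c t * p)) / (s t * s t) =
          - ((c t)\<^sup>2 * (((s t)\<^sup>2 + (c t)\<^sup>2) + 2 * (s t)\<^sup>2) / (s t)\<^sup>2) * p"
        using pos[OF that] by (simp add: field_simps power2_eq_square power3_eq_cube)
      also have "\<dots> = - u1 t * p" unfolding sc u1_def ..
      finally have e: "(3 * (c t)\<^sup>2 * (- s t * p) * s t - c t ^ 3 * (c t * p)) / (s t * s t) = - u1 t * p" .
      have "(u has_real_derivative (3 * (c t)\<^sup>2 * (- s t * p) * s t - c t ^ 3 * (c t * p)) / (s t * s t)) (at t)"
        unfolding u_def using pos[OF that]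
        by (auto intro!: derivative_eq_intros ds dc)
      then show ?thesis unfolding e .
    qed
    have du1: "(u1 has_real_derivative - ((2 * c t / s t ^ 3 + 4 * s t * c t) * p)) (at t)"
      if "t \<in> {0..1}" for t
    proof -
      have "(2 * c t * (- s t * p) * (s t)\<^sup>2 - (c t)\<^sup>2 * (2 * s t * (c t * p))) / ((s t)\<^sup>2 * (s t)\<^sup>2)
          + 2 * (2 * c t * (- s t * p)) =
          - ((2 * c t * ((s t)\<^sup>2 + (c t)\<^sup>2) / s t ^ 3 + 4 * s t * c t) * p)"
        using pos[OF that] by (simp add: field_simps power2_eq_square power3_eq_cube)
      then have e: "(2 * c t * (- s t * p) * (s t)\<^sup>2 - (c t)\<^sup>2 * (2 * s t * (c t * p))) / ((s t)\<^sup>2 * (s t)\<^sup>2)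
          + 2 * (2 * c t * (- s t * p)) = - ((2 * c t / s t ^ 3 + 4 * s t * c t) * p)"
        unfolding sc by simp
      have "((\<lambda>t. (c t)\<^sup>2 / (s t)\<^sup>2 + 2 * (c t)\<^sup>2) has_real_derivative
          (2 * c t * (- s t * p) * (s t)\<^sup>2 - (c t)\<^sup>2 * (2 * s t * (c t * p))) / ((s t)\<^sup>2 * (s t)\<^sup>2)
          + 2 * (2 * c t * (- s t * p))) (at t)"
        using pos[OF that] by (auto intro!: derivative_eq_intros ds dc)
      then have d: "((\<lambda>t. (c t)\<^sup>2 / (s t)\<^sup>2 + 2 * (c t)\<^sup>2) has_real_derivative
          - ((2 * c t / s t ^ 3 + 4 * s t * c t) * p)) (at t)" unfolding e .
      \<comment> \<open>The split form of \<open>u1\<close> agrees with its definition only where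
        \<open>s\<close> is nonzero, so the derivative is transferred through a neighbourhood of
        \<open>t\<close>.\<close>
      have "(s \<longlongrightarrow> s t) (nhds t)"
        using DERIV_isCont[OF ds[of t]] by (simp add: isCont_def tendsto_at_iff_tendsto_nhds)
      then have "\<forall>\<^sub>F t in nhds t. s t > 0"
        using pos(1)[OF that] by (rule order_tendstoD(1))
      then have "\<forall>\<^sub>F t in nhds t. u1 t = (c t)\<^sup>2 / (s t)\<^sup>2 + 2 * (c t)\<^sup>2"
        by eventually_elim (simp add: u1_def field_simps)
      then show ?thesis using d by (subst DERIV_cong_ev[OF refl _ refl])
    qed
    have dw: "((\<lambda>t. (\<tau> t)\<^sup>2) has_real_derivative w1 t * q) (at t)" if "t \<in> {0..1}" for t
      by (rule derivative_eq_intros dt[OF that] refl)+ (simp add: w1_def algebra_simps)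
    have dw1: "(w1 has_real_derivative 2 * (1 + (\<tau> t)\<^sup>2) * (1 + 3 * (\<tau> t)\<^sup>2) * q) (at t)"
      if "t \<in> {0..1}" for t
      unfolding w1_def
      by (rule derivative_eq_intros dt[OF that] refl)+ (simp add: algebra_simps power2_eq_square)
    define f1 where "f1 t = (1 - 2 * (s t)\<^sup>2) * p + u1 t * p * (\<tau> t)\<^sup>2 - u t * (w1 t * q)" for t
    define f2 where "f2 t = - ((2 * c t / s t ^ 3 + 4 * s t * c t) * (\<tau> t)\<^sup>2 * p\<^sup>2 + 4 * s t * c t * p\<^sup>2
      - 2 * u1 t * w1 t * p * q + u t * (2 * (1 + (\<tau> t)\<^sup>2) * (1 + 3 * (\<tau> t)\<^sup>2)) * q\<^sup>2)" for t
    show ?thesis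
    proof (rule f''_le0_imp_concave[where f' = f1 and f'' = f2])
      fix t :: real assume t: "t \<in> {0..1}"
      have "((\<lambda>t. s t * c t - u t * (\<tau> t)\<^sup>2) has_real_derivative f1 t) (at t)"
        by (rule derivative_eq_intros dsc du[OF t] dw[OF t] refl)+ (simp add: f1_def algebra_simps)
      then show "((\<lambda>t. vol_bound (h + t * p) (x + t * q)) has_real_derivative f1 t) (at t)"
        by (simp add: vol_bound_def s_def c_def \<tau>_def u_def)
      show "(f1 has_real_derivative f2 t) (at t)"
        unfolding f1_def
        by (rule derivative_eq_intros ds2 du[OF t] dw[OF t] du1[OF t] dw1[OF t] refl)+
          (simp add: f2_def algebra_simps power2_eq_square)
      show "f2 t \<le> 0"
        using vol_bound_second_derivative_le_0[OF sc pos(1,2)[OF t], where \<tau> = "\<tau> t" and p = p and q = q]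
        by (simp add: f2_def u_def u1_def w1_def algebra_simps)
    qed simp
  qed
  have conv: "convex ({0<..<pi/2} \<times> {-pi/2<..<pi/2})" by (intro convex_Times) auto
  show ?thesis
    unfolding concave_on_def angle_domain_def
  proof (rule convex_onI[OF _ conv])
    fix t :: real and y z :: "real \<times> real"
    assume t: "0 < t" "t < 1" and y: "y \<in> {0<..<pi/2} \<times> {-pi/2<..<pi/2}"
      and z: "z \<in> {0<..<pi/2} \<times> {-pi/2<..<pi/2}"
    obtain h x h' x' where yz: "y = (h, x)" "z = (h', x')" by fastforce
    have line: "(1 - r) *\<^sub>R y + r *\<^sub>R z = (h + r * (h' - h), x + r * (x' - x))" for r
      by (simp add: yz algebra_simps)
    have "concave_on {0..1} (\<lambda>r. vol_bound (h + r * (h' - h)) (x + r * (x' - x)))"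
    proof (rule *)
      fix r :: real assume "r \<in> {0..1}"
      then have "(1 - r) *\<^sub>R y + r *\<^sub>R z \<in> {0<..<pi/2} \<times> {-pi/2<..<pi/2}"
        using conv y z by (auto intro!: convexD)
      then show "h + r * (h' - h) \<in> {0<..<pi/2} \<and> x + r * (x' - x) \<in> {-pi/2<..<pi/2}"
        unfolding line by blast
    qed
    from concave_onD[OF this, of t 0 1]
    show "- (case (1 - t) *\<^sub>R y + t *\<^sub>R z of (h, x) \<Rightarrow> vol_bound h x)
      \<le> (1 - t) * - (case y of (h, x) \<Rightarrow> vol_bound h x) + t * - (case z of (h, x) \<Rightarrow> vol_bound h x)"
      using t unfolding line by (simp add: yz)
  qed
qed

unbundle cross3_syntax

section \<open>Wedges and spherical triangles\<close>

text \<open>Cauchy's functional equation on an interval: nonnegativity makes \<open>M\<close>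
  monotone, which replaces continuity. Trapping \<open>x\<close> between consecutive multiples of c
  / n leaves an error of at most M c / n. It yields the volume of a wedge without any
  integration.\<close>

lemma additive_imp_linear:
  fixes M :: "real \<Rightarrow> real"
  assumes c: "0 < c" and x: "0 \<le> x" "x \<le> c"
    and nonneg: "\<And>y. 0 \<le> y \<Longrightarrow> y \<le> c \<Longrightarrow> 0 \<le> M y"
    and zero: "M 0 = 0"
    and add: "\<And>y z. 0 < y \<Longrightarrow> 0 < z \<Longrightarrow> y + z \<le> c \<Longrightarrow> M (y + z) = M y + M z"
  shows "M x = x / c * M c"
proof -
  have add0: "M (y + z) = M y + M z" if "0 \<le> y" "0 \<le> z" "y + z \<le> c" for y z
    using that add[of y z] zero by (cases "y = 0"; cases "z = 0") auto
  have mono: "M y \<le> M z" if "0 \<le> y" "y \<le> z" "z \<le> c" for y z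
    using add0[of y "z - y"] nonneg[of "z - y"] that by auto
  have mult: "M (real k * h) = real k * M h" if "0 \<le> h" "real k * h \<le> c" for k h
    using that
  proof (induction k)
    case (Suc k)
    then have "real k * h \<le> c" by (simp add: algebra_simps)
    then show ?case using add0[of "real k * h" h] Suc by (simp add: algebra_simps)
  qed (simp add: zero)
  have bound: "\<bar>M x - x / c * M c\<bar> \<le> M c / real n" if n: "0 < n" for n :: nat
  proof (cases "x = c")
    case True
    then show ?thesis using nonneg[of c] c by simp
  next
    case False
    define h where "h = c / real n"
    have h: "0 < h" "real n * h = c" using c n by (auto simp: h_def)
    define k where "k = nat \<lfloor>x / h\<rfloor>"
    have "0 \<le> x / h" using x h by simp
    then have k: "real k \<le> x / h" "x / h < real k + 1"
      unfolding k_def by linarith+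
    then have kx: "real k * h \<le> x" "x \<le> real (Suc k) * h"
      using h by (simp_all add: field_simps)
    have "x / h < real n" using False x h by (simp add: field_simps)
    then have "k < n" using k by linarith
    then have kc: "real (Suc k) * h \<le> c"
      using h by (metis Suc_leI mult_right_mono of_nat_le_iff less_imp_le)
    have 1: "real k * M h \<le> M x"
      using mult[of h k] mono[of "real k * h" x] kx x h by auto
    have 2: "M x \<le> real (Suc k) * M h"
      using mult[of h "Suc k"] mono[of x "real (Suc k) * h"] kx x h kc by auto
    have Mc: "M c = real n * M h" using mult[of h n] h by simp
    have e: "x / c * M c = x / h * M h" unfolding Mc using h n by (simp add: h_def)
    have "h \<le> c" using kc h by (smt (verit) mult_less_cancel_right2 of_nat_Suc of_nat_0_le_iff)
    then have Mh: "0 \<le> M h" using nonneg h by simp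
    have "real k * M h \<le> x / h * M h" "x / h * M h \<le> real (Suc k) * M h"
      using k Mh by (intro mult_right_mono; simp)+
    then have "\<bar>M x - x / c * M c\<bar> \<le> M h"
      using 1 2 unfolding e abs_le_iff by (simp add: algebra_simps)
    then show ?thesis using Mc n by simp
  qed
  have "(\<lambda>n. M c / real n) \<longlonglongrightarrow> 0" by (rule lim_const_over_n)
  then have "\<bar>M x - x / c * M c\<bar> \<le> 0"
  proof (rule tendsto_lowerbound)
    show "\<forall>\<^sub>F n in sequentially. \<bar>M x - x / c * M c\<bar> \<le> M c / real n"
      by (rule eventually_sequentiallyI[of 1]) (rule bound, simp)
  qed simp
  then show ?thesis by simp
qed

lemma lmeasurable_cball_Int_halfspaces:
  fixes a b c :: "'a::euclidean_space"
  shows "{x \<in> cball 0 1. 0 \<le> a \<bullet> x} \<in> lmeasurable"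
    and "{x \<in> cball 0 1. 0 \<le> a \<bullet> x \<and> 0 \<le> b \<bullet> x} \<in> lmeasurable"
    and "{x \<in> cball 0 1. 0 \<le> a \<bullet> x \<and> 0 \<le> b \<bullet> x \<and> 0 \<le> c \<bullet> x} \<in> lmeasurable"
proof -
  have H: "closed {x. 0 \<le> d \<bullet> x}" for d :: 'a by (simp add: closed_halfspace_ge)
  have "{x \<in> cball 0 1. 0 \<le> a \<bullet> x} = cball 0 1 \<inter> {x. 0 \<le> a \<bullet> x}"
    "{x \<in> cball 0 1. 0 \<le> a \<bullet> x \<and> 0 \<le> b \<bullet> x} = cball 0 1 \<inter> ({x. 0 \<le> a \<bullet> x} \<inter> {x. 0 \<le> b \<bullet> x})"
    "{x \<in> cball 0 1. 0 \<le> a \<bullet> x \<and> 0 \<le> b \<bullet> x \<and> 0 \<le> c \<bullet> x} =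
      cball 0 1 \<inter> ({x. 0 \<le> a \<bullet> x} \<inter> {x. 0 \<le> b \<bullet> x} \<inter> {x. 0 \<le> c \<bullet> x})"
    by auto
  then show "{x \<in> cball 0 1. 0 \<le> a \<bullet> x} \<in> lmeasurable"
    "{x \<in> cball 0 1. 0 \<le> a \<bullet> x \<and> 0 \<le> b \<bullet> x} \<in> lmeasurable"
    "{x \<in> cball 0 1. 0 \<le> a \<bullet> x \<and> 0 \<le> b \<bullet> x \<and> 0 \<le> c \<bullet> x} \<in> lmeasurable"
    by (simp_all only: lmeasurable_compact compact_Int_closed compact_cball closed_Int H)
qed

lemma measure_Int_halfspace_split:
  fixes S :: "'a::euclidean_space set"
  assumes "a \<noteq> 0" "{x \<in> S. 0 \<le> a \<bullet> x} \<in> lmeasurable" "{x \<in> S. 0 \<le> (- a) \<bullet> x} \<in> lmeasurable"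
  shows "measure lebesgue S =
    measure lebesgue {x \<in> S. 0 \<le> a \<bullet> x} + measure lebesgue {x \<in> S. 0 \<le> (- a) \<bullet> x}"
proof -
  have "negligible ({x \<in> S. 0 \<le> a \<bullet> x} \<inter> {x \<in> S. 0 \<le> (- a) \<bullet> x})"
    by (rule negligible_subset[OF negligible_hyperplane[of a 0]]) (use assms in auto)
  moreover have "S = {x \<in> S. 0 \<le> a \<bullet> x} \<union> {x \<in> S. 0 \<le> (- a) \<bullet> x}" by auto
  ultimately show ?thesis using assms(2,3) measure_Un3_negligible
    by (smt (verit) measure_Un2 measure_Un3 negligible_imp_measure0)
qed

lemma measure_half_cball:
  fixes a :: "real^3"
  assumes "a \<noteq> 0"
  shows "measure lebesgue {x \<in> cball 0 1. 0 \<le> a \<bullet> x} = 2 * pi / 3"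
proof -
  have "(\<lambda>x. - x) ` {x \<in> cball 0 1. 0 \<le> a \<bullet> x} = {x \<in> cball 0 1. 0 \<le> (- a) \<bullet> x}"
    by (auto simp: image_iff intro!: exI[of _ "- _"])
  then have "measure lebesgue {x \<in> cball 0 1. 0 \<le> (- a) \<bullet> x} =
      measure lebesgue {x \<in> cball 0 1. 0 \<le> a \<bullet> x}"
    using measure_orthogonal_image[of "\<lambda>x::real^3. - x", OF _ lmeasurable_cball_Int_halfspaces(1)[of a]]
    by (simp add: orthogonal_transformation_neg orthogonal_transformation_id)
  moreover have "measure lebesgue (cball (0::real^3) 1) = 4 * pi / 3"
    by (simp add: content_cball unit_ball_vol_3)
  ultimately show ?thesis
    using measure_Int_halfspace_split[OF assms lmeasurable_cball_Int_halfspaces(1)[of a] lmeasurable_cball_Int_halfspaces(1)[of "- a"]]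
    by simp
qed

text \<open>The cross product completes a and b to an orthonormal basis, hence to an orthogonal map
  of the ball. A region described by two coordinates can thus be placed in any orthonormal
  frame.\<close>

lemma measure_cball_orthonormal:
  fixes a b :: "real^3"
  assumes "norm a = 1" "norm b = 1" "a \<bullet> b = 0"
    and meas: "{x::real^3 \<in> cball 0 1. R (x$1) (x$2)} \<in> lmeasurable"
  shows "measure lebesgue {y \<in> cball 0 1. R (a \<bullet> y) (b \<bullet> y)} =
    measure lebesgue {x::real^3 \<in> cball 0 1. R (x$1) (x$2)}"
proof -
  define f where "f x = x$1 *\<^sub>R a + x$2 *\<^sub>R b + x$3 *\<^sub>R (a \<times> b)" for x :: "real^3"
  have ab: "a \<bullet> a = 1" "b \<bullet> b = 1" "b \<bullet> a = 0" "a \<bullet> b = 0"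
    using assms by (simp_all add: norm_eq_1 inner_commute)
  then have cc: "(a \<times> b) \<bullet> (a \<times> b) = 1" by (simp add: dot_cross)
  have inner: "f x \<bullet> f y = x \<bullet> y" for x y
  proof -
    have "f x \<bullet> f y = x$1 * y$1 + x$2 * y$2 + x$3 * y$3"
      by (simp add: f_def inner_add_left inner_add_right ab cc dot_cross_self)
    then show ?thesis by (simp add: inner_vec_def sum_3)
  qed
  have "linear f" by (rule linearI) (simp_all add: f_def algebra_simps)
  then have orth: "orthogonal_transformation f"
    by (simp add: orthogonal_transformation_def inner)
  have coord: "a \<bullet> f x = x$1" "b \<bullet> f x = x$2" for x
    by (simp_all add: f_def inner_add_right ab dot_cross_self)
  have "f ` {x \<in> cball 0 1. R (x$1) (x$2)} = {y \<in> cball 0 1. R (a \<bullet> y) (b \<bullet> y)}"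
  proof (intro equalityI subsetI)
    fix y assume y: "y \<in> {y \<in> cball 0 1. R (a \<bullet> y) (b \<bullet> y)}"
    obtain x where "y = f x"
      using orthogonal_transformation_surj[OF orth] by (metis surjD)
    then show "y \<in> f ` {x \<in> cball 0 1. R (x$1) (x$2)}"
      using y orth by (auto simp: coord orthogonal_transformation_norm)
  qed (use orth in \<open>auto simp: coord orthogonal_transformation_norm\<close>)
  then show ?thesis using measure_orthogonal_image[OF orth meas] by simp
qed

text \<open>In the plane of the first two coordinates this is the sector of arguments from 0 to
  \<theta>. Cutting the sector of angle t + s at argument t leaves the sector of angle t and a
  rotated copy of the sector of angle s, so the volume is additive in the angle; at pi it is the
  half-ball.\<close>

lemma measure_standard_wedge:
  assumes "0 \<le> \<theta>" "\<theta> \<le> pi"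
  shows "measure lebesgue {x::real^3 \<in> cball 0 1. 0 \<le> x$2 \<and> 0 \<le> sin \<theta> * x$1 - cos \<theta> * x$2} =
    2 * \<theta> / 3"
proof -
  define Q where "Q t = {x::real^3 \<in> cball 0 1. 0 \<le> x$2 \<and> 0 \<le> sin t * x$1 - cos t * x$2}" for t
  define e :: "real \<Rightarrow> real^3" where "e t = sin t *\<^sub>R axis 1 1 - cos t *\<^sub>R axis 2 1" for t
  have inner_e: "e t \<bullet> x = sin t * x$1 - cos t * x$2" for t x
    by (simp add: e_def inner_diff_left inner_axis')
  have e_nz: "e t \<noteq> 0" for t
  proof
    assume "e t = 0"
    then have "e t \<bullet> axis 1 1 = 0" "e t \<bullet> axis 2 1 = 0" by simp_all
    then have "sin t = 0" "cos t = 0" by (simp_all add: inner_e axis_def)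
    then show False using sin_cos_squared_add[of t] by simp
  qed
  have Q_alt: "Q t = {x \<in> cball 0 1. 0 \<le> axis 2 1 \<bullet> x \<and> 0 \<le> e t \<bullet> x}" for t
    by (simp add: Q_def inner_e inner_axis')
  have Qm: "Q t \<in> lmeasurable" for t
    unfolding Q_alt by (rule lmeasurable_cball_Int_halfspaces)
  define M where "M t = measure lebesgue (Q t)" for t
  have Mpi: "M pi = 2 * pi / 3"
    using measure_half_cball[of "axis 2 1 :: real^3"]
    by (simp add: M_def Q_def inner_axis' axis_eq_0_iff)
  have M0: "M 0 = 0"
    unfolding M_def
    by (rule negligible_imp_measure0, rule negligible_subset[OF negligible_hyperplane[of "axis 2 1 :: real^3" 0]])
      (auto simp: Q_def inner_axis' axis_eq_0_iff)
  have Madd: "M (t + s) = M t + M s" if ts: "0 < t" "0 < s" "t + s \<le> pi" for t s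
  proof -
    \<comment> \<open>The pair \<open>a\<close>, \<open>- e t\<close> is the standard frame of the
      first two axes rotated by t.\<close>
    define a :: "real^3" where "a = cos t *\<^sub>R axis 1 1 + sin t *\<^sub>R axis 2 1"
    have "a \<bullet> (- e t) = 0" by (simp add: a_def e_def inner_add_left inner_diff_right inner_axis_axis)
    moreover have "norm a = 1" "norm (- e t) = 1"
      by (simp_all add: norm_eq_1 a_def e_def inner_diff_left inner_diff_right inner_add_left
          inner_add_right inner_axis_axis flip: power2_eq_square)
    ultimately have rot: "measure lebesgue {y \<in> cball 0 1. 0 \<le> (- e t) \<bullet> y \<and>
        0 \<le> sin s * (a \<bullet> y) - cos s * ((- e t) \<bullet> y)} = M s"
      unfolding M_def Q_def
      using measure_cball_orthonormal[of a "- e t" "\<lambda>u v. 0 \<le> v \<and> 0 \<le> sin s * u - cos s * v"]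
        Qm[of s] by (simp add: Q_def)
    have e_rot: "sin s * (a \<bullet> y) - cos s * ((- e t) \<bullet> y) = e (t + s) \<bullet> y" for y
      by (simp add: a_def inner_add_left inner_e inner_axis' sin_add cos_add algebra_simps)
    \<comment> \<open>A linear relation between the three bounding normals. Its signs show that the
      outer constraint is automatic on the first piece, and the constraint on the second coordinate
      on the other.\<close>
    have combine: "sin t * (e (t + s) \<bullet> y) = sin (t + s) * (e t \<bullet> y) + sin s * y$2" for y
    proof -
      have "sin s * y$2 = sin ((t + s) - t) * y$2" by simp
      also have "\<dots> = (sin (t + s) * cos t - cos (t + s) * sin t) * y$2" by (simp only: sin_diff)
      finally show ?thesis by (simp add: inner_e algebra_simps)
    qed
    have pos: "0 < sin t" "0 < sin s" "0 \<le> sin (t + s)"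
      using ts by (auto intro!: sin_gt_zero sin_ge_zero)
    have A: "0 \<le> e (t + s) \<bullet> y" if "0 \<le> y$2" "0 \<le> e t \<bullet> y" for y
    proof -
      have "0 \<le> sin t * (e (t + s) \<bullet> y)" unfolding combine using that pos by simp
      then show ?thesis using pos by (simp add: zero_le_mult_iff)
    qed
    have B: "0 \<le> y$2" if "0 \<le> e (t + s) \<bullet> y" "0 \<le> (- e t) \<bullet> y" for y
    proof -
      have "sin (t + s) * (e t \<bullet> y) \<le> 0" using that pos by (simp add: mult_nonneg_nonpos)
      then have "0 \<le> sin s * y$2" using combine[of y] that pos by (smt (verit) mult_nonneg_nonneg)
      then show ?thesis using pos by (simp add: zero_le_mult_iff)
    qed
    have 1: "{x \<in> Q (t + s). 0 \<le> e t \<bullet> x} = Q t"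
      using A by (auto simp: Q_alt inner_axis')
    have 2: "{x \<in> Q (t + s). 0 \<le> (- e t) \<bullet> x} =
        {y \<in> cball 0 1. 0 \<le> (- e t) \<bullet> y \<and> 0 \<le> e (t + s) \<bullet> y}"
      using B by (auto simp: Q_alt inner_axis')
    have "M (t + s) = measure lebesgue {x \<in> Q (t + s). 0 \<le> e t \<bullet> x} +
        measure lebesgue {x \<in> Q (t + s). 0 \<le> (- e t) \<bullet> x}"
      unfolding M_def
      by (rule measure_Int_halfspace_split[OF e_nz])
        (simp_all only: 1 2 Qm lmeasurable_cball_Int_halfspaces)
    then show ?thesis using rot unfolding e_rot 1 2 M_def by simp
  qed
  have "M \<theta> = \<theta> / pi * M pi"
    by (rule additive_imp_linear) (use assms M0 Madd in \<open>auto simp: M_def\<close>)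
  then show ?thesis by (simp add: Mpi) (simp add: M_def Q_def)
qed

text \<open>A zero vector gets the angle \<open>arccos 0\<close>, that is pi / 2, so
  \<open>cos_vec_angle\<close> holds for it as well.\<close>

definition vec_angle :: "'a::real_inner \<Rightarrow> 'a \<Rightarrow> real" where
  "vec_angle a b = arccos (a \<bullet> b / (norm a * norm b))"

lemma cos_vec_angle: "cos (vec_angle a b) = a \<bullet> b / (norm a * norm b)"
proof -
  have "\<bar>a \<bullet> b\<bar> \<le> norm a * norm b" by (rule Cauchy_Schwarz_ineq2)
  then have "\<bar>a \<bullet> b / (norm a * norm b)\<bar> \<le> 1" by (cases "a = 0 \<or> b = 0") (auto simp: divide_le_eq_1 abs_mult)
  then show ?thesis unfolding vec_angle_def by (rule cos_arccos_abs)
qed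

text \<open>The vectors a and b are inner normals, so the dihedral angle of the wedge is pi minus
  the angle between them.\<close>

lemma measure_wedge:
  fixes a b :: "real^3"
  assumes "a \<noteq> 0" "b \<noteq> 0"
  shows "measure lebesgue {x \<in> cball 0 1. 0 \<le> a \<bullet> x \<and> 0 \<le> b \<bullet> x} = 2 / 3 * (pi - vec_angle a b)"
proof -
  have *: "measure lebesgue {x \<in> cball 0 1. 0 \<le> a \<bullet> x \<and> 0 \<le> b \<bullet> x} = 2 / 3 * (pi - arccos (a \<bullet> b))"
    if a: "norm a = 1" and b: "norm b = 1" for a b :: "real^3"
  proof -
    define c s where "c = a \<bullet> b" and "s = sqrt (1 - c\<^sup>2)"
    have aa: "a \<bullet> a = 1" "b \<bullet> b = 1" using a b by (simp_all add: norm_eq_1)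
    have "\<bar>c\<bar> \<le> 1" using Cauchy_Schwarz_ineq2[of a b] a b by (simp add: c_def)
    then have c: "-1 \<le> c" "c \<le> 1" "c\<^sup>2 \<le> 1" by (auto simp: abs_square_le_1)
    have n: "(norm (b - c *\<^sub>R a))\<^sup>2 = s\<^sup>2"
      using c by (simp add: power2_norm_eq_inner inner_diff_left inner_diff_right aa s_def
          inner_commute[of b a] flip: c_def) (simp add: power2_eq_square)
    have ns: "norm (b - c *\<^sub>R a) = s" by (rule power2_eq_imp_eq[OF n]) (use c in \<open>simp_all add: s_def\<close>)
    \<comment> \<open>Gram-Schmidt. If b is parallel to a, the residual vanishes and any unit vector
      orthogonal to a serves. In the frame (e, a) the wedge becomes the standard one.\<close>
    obtain e where e: "norm e = 1" "e \<bullet> a = 0" "b = c *\<^sub>R a + s *\<^sub>R e"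
    proof (cases "s = 0")
      case True
      obtain e :: "real^3" where "e \<noteq> 0" "e \<bullet> a = 0"
        using orthogonal_to_vector_exists[of a] by (auto simp: orthogonal_def inner_commute)
      then show ?thesis using that[of "e /\<^sub>R norm e"] True ns by simp
    next
      case False
      then have "norm ((b - c *\<^sub>R a) /\<^sub>R s) = 1" using ns c by (simp add: s_def)
      moreover have "((b - c *\<^sub>R a) /\<^sub>R s) \<bullet> a = 0"
        by (simp add: inner_diff_left inner_diff_right aa c_def inner_commute[of b a])
      ultimately show ?thesis using that[of "(b - c *\<^sub>R a) /\<^sub>R s"] False by simp
    qed
    define \<theta> where "\<theta> = pi - arccos c"
    have \<theta>: "0 \<le> \<theta>" "\<theta> \<le> pi" "cos \<theta> = - c" "sin \<theta> = s"
      using c arccos_ubound[of c] arccos_lbound[of c]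
      by (simp_all add: \<theta>_def s_def sin_arccos_abs sin_arccos)
    have "{x::real^3 \<in> cball 0 1. 0 \<le> x$2 \<and> 0 \<le> sin \<theta> * x$1 - cos \<theta> * x$2} =
      {x \<in> cball 0 1. 0 \<le> axis 2 1 \<bullet> x \<and> 0 \<le> (sin \<theta> *\<^sub>R axis 1 1 - cos \<theta> *\<^sub>R axis 2 1) \<bullet> x}"
      by (simp add: inner_diff_left inner_axis')
    then have m: "{x::real^3 \<in> cball 0 1. 0 \<le> x$2 \<and> 0 \<le> sin \<theta> * x$1 - cos \<theta> * x$2} \<in> lmeasurable"
      by (simp only: lmeasurable_cball_Int_halfspaces)
    have "b \<bullet> x = sin \<theta> * (e \<bullet> x) - cos \<theta> * (a \<bullet> x)" for x
      using e \<theta> by (simp add: inner_add_left)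
    then show ?thesis
      using measure_cball_orthonormal[of e a "\<lambda>u v. 0 \<le> v \<and> 0 \<le> sin \<theta> * u - cos \<theta> * v", OF e(1) a e(2) m]
        measure_standard_wedge[OF \<theta>(1,2)] by (simp add: \<theta>_def c_def)
  qed
  have "0 \<le> (a /\<^sub>R norm a) \<bullet> x \<longleftrightarrow> 0 \<le> a \<bullet> x" "0 \<le> (b /\<^sub>R norm b) \<bullet> x \<longleftrightarrow> 0 \<le> b \<bullet> x" for x
    using assms by (simp_all add: zero_le_mult_iff divide_inverse)
  then show ?thesis using *[of "a /\<^sub>R norm a" "b /\<^sub>R norm b"] assms
    by (simp add: vec_angle_def divide_simps mult.commute)
qed

text \<open>The eight octants cut out by the three planes come in antipodal pairs, and two octants
  that share a face form a wedge.\<close>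

lemma girard:
  fixes a b c :: "real^3"
  assumes nz: "a \<noteq> 0" "b \<noteq> 0" "c \<noteq> 0"
  shows "3 * measure lebesgue {x \<in> cball 0 1. 0 \<le> a \<bullet> x \<and> 0 \<le> b \<bullet> x \<and> 0 \<le> c \<bullet> x} =
    2 * pi - vec_angle a b - vec_angle b c - vec_angle c a"
proof -
  define O3 where "O3 a b c = measure lebesgue {x::real^3 \<in> cball 0 1. 0 \<le> a \<bullet> x \<and> 0 \<le> b \<bullet> x \<and> 0 \<le> c \<bullet> x}" for a b c
  define O2 where "O2 a b = measure lebesgue {x::real^3 \<in> cball 0 1. 0 \<le> a \<bullet> x \<and> 0 \<le> b \<bullet> x}" for a b
  have swap: "O3 a b c = O3 b c a" for a b c unfolding O3_def by (rule arg_cong[where f = "measure lebesgue"]) auto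
  have neg: "O3 (- a) (- b) (- c) = O3 a b c" for a b c
  proof -
    have "(\<lambda>x. - x) ` {x \<in> cball 0 1. 0 \<le> a \<bullet> x \<and> 0 \<le> b \<bullet> x \<and> 0 \<le> c \<bullet> x} =
        {x \<in> cball 0 1. 0 \<le> (- a) \<bullet> x \<and> 0 \<le> (- b) \<bullet> x \<and> 0 \<le> (- c) \<bullet> x}"
      by (auto simp: image_iff intro!: exI[of _ "- _"])
    then show ?thesis unfolding O3_def
      using measure_orthogonal_image[of "\<lambda>x::real^3. - x", OF _ lmeasurable_cball_Int_halfspaces(3)[of a b c]]
      by (simp add: orthogonal_transformation_neg orthogonal_transformation_id)
  qed
  have split: "O2 a b = O3 a b c + O3 a b (- c)" if "c \<noteq> 0" for a b c
  proof -
    have *: "{x \<in> {x \<in> cball 0 1. 0 \<le> a \<bullet> x \<and> 0 \<le> b \<bullet> x}. 0 \<le> c \<bullet> x} =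
      {x \<in> cball 0 1. 0 \<le> a \<bullet> x \<and> 0 \<le> b \<bullet> x \<and> 0 \<le> c \<bullet> x}" for c by auto
    show ?thesis unfolding O2_def O3_def
      using measure_Int_halfspace_split[OF that, of "{x \<in> cball 0 1. 0 \<le> a \<bullet> x \<and> 0 \<le> b \<bullet> x}"]
      unfolding * by (simp only: lmeasurable_cball_Int_halfspaces)
  qed
  have half: "O2 a b + O2 a (- b) = 2 * pi / 3"
  proof -
    have *: "{x \<in> {x \<in> cball 0 1. 0 \<le> a \<bullet> x}. 0 \<le> b \<bullet> x} =
      {x \<in> cball 0 1. 0 \<le> a \<bullet> x \<and> 0 \<le> b \<bullet> x}" for b by auto
    show ?thesis unfolding O2_def measure_half_cball[OF nz(1), symmetric]
      using measure_Int_halfspace_split[OF nz(2), of "{x \<in> cball 0 1. 0 \<le> a \<bullet> x}"]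
      unfolding * by (simp only: lmeasurable_cball_Int_halfspaces)
  qed
  have "O2 a b = O3 a b c + O3 a b (- c)" "O2 a (- b) = O3 a (- b) c + O3 a (- b) (- c)"
    using split nz by blast+
  moreover have "O2 b c = O3 a b c + O3 (- a) b c"
    using split[OF nz(1), of b c] swap[of a b c] swap[of "- a" b c] by linarith
  moreover have "O2 c a = O3 a b c + O3 a (- b) c"
    using split[OF nz(2), of c a] swap[of c a b] swap[of c a "- b"] by linarith
  moreover have "O3 a (- b) (- c) = O3 (- a) b c" using neg[of "- a" b c] by simp
  \<comment> \<open>Up to antipodes, the half-ball on the positive side of a consists of the octant
    \<open>O3 a b c\<close> and its three neighbours. The three wedges contain each neighbour once
    and this octant three times.\<close>
  ultimately have "O2 a b + O2 b c + O2 c a = 2 * O3 a b c + 2 * pi / 3"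
    using half by linarith
  moreover have "O2 a b = 2 / 3 * (pi - vec_angle a b)" "O2 b c = 2 / 3 * (pi - vec_angle b c)"
    "O2 c a = 2 / 3 * (pi - vec_angle c a)"
    unfolding O2_def using nz measure_wedge by blast+
  ultimately have "2 * O3 a b c + 2 * pi / 3 =
      2 / 3 * (pi - vec_angle a b) + 2 / 3 * (pi - vec_angle b c) + 2 / 3 * (pi - vec_angle c a)"
    by simp
  then have "3 * O3 a b c = 2 * pi - vec_angle a b - vec_angle b c - vec_angle c a"
    by (simp add: field_simps)
  then show ?thesis unfolding O3_def .
qed

section \<open>Extremal triangles\<close>

text \<open>For a spherical triangle with angles \<open>\<phi>, \<psi>, \<omega>\<close>, the hypothesis on \<open>d\<close> determines the
  determinant of the three vertices.  For fixed \<open>\<phi>\<close> and \<open>\<psi> + \<omega>\<close> it is largest when \<open>\<psi> = \<omega>\<close>.\<close>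

lemma triangle_det_le_vol_bound:
  fixes d \<phi> \<psi> \<omega> :: real
  assumes ang: "0 < \<phi>" "\<phi> < pi" "0 < \<psi>" "\<psi> < pi" "0 < \<omega>" "\<omega> < pi" and d: "0 < d"
    and eq: "d * (sin \<phi> * sin \<psi> * sin \<omega>) =
      1 - (cos \<phi>)\<^sup>2 - (cos \<psi>)\<^sup>2 - (cos \<omega>)\<^sup>2 - 2 * cos \<phi> * cos \<psi> * cos \<omega>"
  shows "d \<le> 2 * vol_bound (\<phi> / 2) ((pi - \<psi> - \<omega>) / 2)"
proof -
  define h \<sigma> \<delta> where "h = \<phi> / 2" and "\<sigma> = (\<psi> + \<omega>) / 2" and "\<delta> = (\<psi> - \<omega>) / 2"
  \<comment> \<open>Only Y depends on \<psi> - \<omega>, so the comparison with the isosceles case Y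
    = 0 comes down to (Z - Y) / (X - Y) \<le> Z / X.\<close>
  define X Y Z where "X = (sin \<sigma>)\<^sup>2" and "Y = (sin \<delta>)\<^sup>2" and "Z = (cos h)\<^sup>2"
  have angs: "\<phi> = 2 * h" "\<psi> = \<sigma> + \<delta>" "\<omega> = \<sigma> - \<delta>" by (simp_all add: h_def \<sigma>_def \<delta>_def field_simps)
  have pos: "0 < sin h" "0 < cos h" "0 < sin \<sigma>"
    using ang by (simp_all add: h_def \<sigma>_def sin_gt_zero cos_gt_zero)
  have cs: "(cos \<sigma>)\<^sup>2 = 1 - X" "(cos \<delta>)\<^sup>2 = 1 - Y" "(sin h)\<^sup>2 = 1 - Z"
    by (simp_all add: X_def Y_def Z_def cos_squared_eq[of \<sigma>] cos_squared_eq[of \<delta>] sin_squared_eq[of h])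
  have prod_sin: "sin \<psi> * sin \<omega> = X - Y"
  proof -
    have "sin \<psi> * sin \<omega> = (sin \<sigma>)\<^sup>2 * (cos \<delta>)\<^sup>2 - (cos \<sigma>)\<^sup>2 * (sin \<delta>)\<^sup>2"
      by (simp add: angs sin_add sin_diff algebra_simps power2_eq_square)
    then show ?thesis unfolding cs by (simp add: X_def Y_def algebra_simps)
  qed
  have prod_cos: "cos \<psi> * cos \<omega> = 1 - X - Y"
  proof -
    have "cos \<psi> * cos \<omega> = (cos \<sigma>)\<^sup>2 * (cos \<delta>)\<^sup>2 - (sin \<sigma>)\<^sup>2 * (sin \<delta>)\<^sup>2"
      by (simp add: angs cos_add cos_diff algebra_simps power2_eq_square)
    then show ?thesis unfolding cs by (simp add: X_def Y_def algebra_simps)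
  qed
  have sum_cos: "(cos \<psi>)\<^sup>2 + (cos \<omega>)\<^sup>2 = 2 * ((1 - X) * (1 - Y) + X * Y)"
  proof -
    have "(cos \<psi>)\<^sup>2 + (cos \<omega>)\<^sup>2 =
        2 * ((cos \<sigma>)\<^sup>2 * (cos \<delta>)\<^sup>2 + (sin \<sigma>)\<^sup>2 * (sin \<delta>)\<^sup>2)"
      by (simp add: angs cos_add cos_diff algebra_simps power2_eq_square)
    then show ?thesis unfolding cs by (simp add: X_def Y_def)
  qed
  have cos_phi: "cos \<phi> = 2 * Z - 1" by (simp add: angs cos_double_cos Z_def)
  have "1 - (cos \<phi>)\<^sup>2 - (cos \<psi>)\<^sup>2 - (cos \<omega>)\<^sup>2 - 2 * cos \<phi> * cos \<psi> * cos \<omega> =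
      1 - (cos \<phi>)\<^sup>2 - ((cos \<psi>)\<^sup>2 + (cos \<omega>)\<^sup>2) - 2 * cos \<phi> * (cos \<psi> * cos \<omega>)" by simp
  also have "\<dots> = 4 * (X - Z) * (Z - Y)"
    unfolding prod_cos sum_cos cos_phi by (simp add: algebra_simps power2_eq_square)
  finally have eq': "d * (sin \<phi> * (X - Y)) = 4 * ((X - Z) * (Z - Y))"
    using eq prod_sin by (simp add: mult.assoc)
  have sphi: "sin \<phi> = 2 * sin h * cos h" by (simp add: angs sin_double)
  have XY: "0 < X - Y" using ang unfolding prod_sin[symmetric] by (intro mult_pos_pos sin_gt_zero) auto
  have XZ: "0 < (X - Z) * (Z - Y)" using eq' d XY pos by (smt (verit) mult_pos_pos sphi)
  \<comment> \<open>If both factors were negative, then X < Z < Y, against Y < X.\<close>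
  have XZ': "Z < X" using XZ XY by (auto simp: zero_less_mult_iff)
  have "Y \<ge> 0" "X > 0" using pos by (simp_all add: X_def Y_def)
  then have "(Z - Y) * X \<le> Z * (X - Y)" using mult_left_mono[of Z X Y] XZ' by (simp add: algebra_simps)
  then have "(Z - Y) / (X - Y) \<le> Z / X" using XY \<open>X > 0\<close> by (simp add: divide_simps mult.commute)
  then have "4 * (X - Z) / sin \<phi> * ((Z - Y) / (X - Y)) \<le> 4 * (X - Z) / sin \<phi> * (Z / X)"
    using XZ' pos by (intro mult_left_mono) (simp_all add: sphi)
  moreover have "d = 4 * (X - Z) / sin \<phi> * ((Z - Y) / (X - Y))"
    using eq' XY pos sphi by (simp add: field_simps)
  ultimately have d: "d \<le> 4 * (X - Z) / sin \<phi> * (Z / X)" by simp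
  have cx: "cos ((pi - \<psi> - \<omega>) / 2) = sin \<sigma>" "sin ((pi - \<psi> - \<omega>) / 2) = cos \<sigma>"
  proof -
    have e: "(pi - \<psi> - \<omega>) / 2 = pi / 2 - \<sigma>" by (simp add: \<sigma>_def field_simps)
    show "cos ((pi - \<psi> - \<omega>) / 2) = sin \<sigma>" "sin ((pi - \<psi> - \<omega>) / 2) = cos \<sigma>"
      unfolding e by (simp_all add: sin_diff cos_diff)
  qed
  have "vol_bound h ((pi - \<psi> - \<omega>) / 2) = cot h * (((sin h)\<^sup>2 - (cos \<sigma>)\<^sup>2) / (sin \<sigma>)\<^sup>2)"
    using vol_bound_alt[of h "(pi - \<psi> - \<omega>) / 2"] pos cx by simp
  also have "\<dots> = cot h * ((X - Z) / X)" unfolding cs by (simp add: X_def)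
  also have "2 * \<dots> = 4 * (X - Z) / sin \<phi> * (Z / X)"
    using pos \<open>X > 0\<close> by (simp add: sphi cot_def Z_def field_simps power2_eq_square)
  finally show ?thesis using d by (simp add: h_def)
qed

lemma vec_angle_bounds:
  fixes a b :: "real^3"
  assumes "a \<times> b \<noteq> 0"
  shows "0 < vec_angle a b" "vec_angle a b < pi"
    and sin_vec_angle: "sin (vec_angle a b) = norm (a \<times> b) / (norm a * norm b)"
proof -
  have nz: "a \<noteq> 0" "b \<noteq> 0" using assms by auto
  define t where "t = a \<bullet> b / (norm a * norm b)"
  have "1 - t\<^sup>2 = ((norm a * norm b)\<^sup>2 - (a \<bullet> b)\<^sup>2) / (norm a * norm b)\<^sup>2"
    using nz by (simp add: t_def power_divide diff_divide_distrib)
  also have "\<dots> = (norm (a \<times> b) / (norm a * norm b))\<^sup>2"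
    by (simp add: norm_cross power_divide power_mult_distrib)
  finally have t: "1 - t\<^sup>2 = (norm (a \<times> b) / (norm a * norm b))\<^sup>2" .
  also have "\<dots> > 0" using nz assms by simp
  finally have "t\<^sup>2 < 1" by simp
  then have t1: "-1 < t" "t < 1" by (auto simp: abs_square_less_1)
  then show "0 < vec_angle a b" "vec_angle a b < pi"
    using arccos_lt_bounded[of t] by (auto simp: vec_angle_def t_def)
  have "sin (vec_angle a b) = sqrt (1 - t\<^sup>2)"
    using t1 by (simp add: vec_angle_def t_def sin_arccos)
  then show "sin (vec_angle a b) = norm (a \<times> b) / (norm a * norm b)"
    unfolding t by simp
qed

text \<open>Polarity is an involution up to scale: the normals of the sides have the original
  vertices as their cross products, multiplied by the determinant.\<close>

lemma cross_cross_shared: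
  fixes u v w :: "real^3"
  shows "(u \<times> v) \<times> (v \<times> w) = (v \<bullet> (w \<times> u)) *\<^sub>R v"
proof -
  have "w \<bullet> (u \<times> v) = v \<bullet> (w \<times> u)" by (metis cross_triple inner_commute)
  then show ?thesis by (simp add: Lagrange dot_cross_self inner_commute)
qed

text \<open>Here a, b, c are inner normals of the planes opposite v, w, u, so the angles of the
  triangle are pi minus the angles between them. All pairwise cross products of a, b, c have norm d,
  the determinant of the vertices, which expresses the sines through d.\<close>

lemma det_le_vol_bound:
  fixes u v w :: "real^3"
  assumes unit: "norm v = 1" "norm w = 1" "norm u = 1" and D: "0 < v \<bullet> (w \<times> u)"
  defines "a \<equiv> w \<times> u" and "b \<equiv> u \<times> v" and "c \<equiv> v \<times> w"
  shows "v \<bullet> (w \<times> u) \<le> 2 * vol_bound ((pi - vec_angle b c) / 2) ((vec_angle c a + vec_angle a b - pi) / 2)"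
    and "0 < vec_angle b c" "vec_angle b c < pi" "0 < vec_angle c a" "vec_angle c a < pi"
    "0 < vec_angle a b" "vec_angle a b < pi"
proof -
  define d where "d = v \<bullet> (w \<times> u)"
  define p q r where "p = v \<bullet> w" and "q = v \<bullet> u" and "r = w \<bullet> u"
  have d_cyc: "w \<bullet> (u \<times> v) = d" "u \<bullet> (v \<times> w) = d"
    unfolding d_def by (metis cross_triple inner_commute)+
  have dot: "b \<bullet> c = p * q - r" "c \<bullet> a = p * r - q" "a \<bullet> b = q * r - p"
    using unit by (simp_all add: a_def b_def c_def dot_cross p_def q_def r_def inner_commute norm_eq_1 algebra_simps)
  have norms: "(norm a)\<^sup>2 = 1 - r\<^sup>2" "(norm b)\<^sup>2 = 1 - q\<^sup>2" "(norm c)\<^sup>2 = 1 - p\<^sup>2"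
    using unit by (simp_all add: a_def b_def c_def norm_cross p_def q_def r_def inner_commute)
  have cr: "b \<times> c = d *\<^sub>R v" "c \<times> a = d *\<^sub>R w" "a \<times> b = d *\<^sub>R u"
    unfolding a_def b_def c_def cross_cross_shared d_cyc by (simp_all add: d_def)
  have d: "0 < d" using D by (simp add: d_def)
  have ncr: "norm (b \<times> c) = d" "norm (c \<times> a) = d" "norm (a \<times> b) = d"
    using d unit by (simp_all add: cr)
  then have nz: "b \<times> c \<noteq> 0" "c \<times> a \<noteq> 0" "a \<times> b \<noteq> 0" using d by auto
  then have nz': "norm a \<noteq> 0" "norm b \<noteq> 0" "norm c \<noteq> 0" by auto
  show bounds: "0 < vec_angle b c" "vec_angle b c < pi" "0 < vec_angle c a" "vec_angle c a < pi"
    "0 < vec_angle a b" "vec_angle a b < pi"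
    using nz vec_angle_bounds(1,2) by blast+
  have d2: "d\<^sup>2 = 1 + 2 * p * q * r - p\<^sup>2 - q\<^sup>2 - r\<^sup>2"
  proof -
    have "d\<^sup>2 = (norm b)\<^sup>2 * (norm c)\<^sup>2 - (b \<bullet> c)\<^sup>2" using norm_cross[of b c] ncr by simp
    then show ?thesis unfolding norms dot by (simp add: algebra_simps power2_eq_square)
  qed
  define N where "N = (norm a)\<^sup>2 * (norm b)\<^sup>2 * (norm c)\<^sup>2"
  have N: "N \<noteq> 0" using nz' by (simp add: N_def)
  have "d * (sin (vec_angle b c) * sin (vec_angle c a) * sin (vec_angle a b)) = (d\<^sup>2)\<^sup>2 / N"
    by (simp add: sin_vec_angle nz ncr N_def power2_eq_square mult_ac)
  \<comment> \<open>The Gram determinant of a, b, c is the square of that of v, w, u. Dividing by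
    the squared norms turns it into an expression in the cosines alone.\<close>
  also have "(d\<^sup>2)\<^sup>2 = (1 - r\<^sup>2) * (1 - q\<^sup>2) * (1 - p\<^sup>2) - (1 - r\<^sup>2) * (p * q - r)\<^sup>2 - (1 - q\<^sup>2) * (p * r - q)\<^sup>2
      - (1 - p\<^sup>2) * (q * r - p)\<^sup>2 + 2 * (p * q - r) * (p * r - q) * (q * r - p)"
    unfolding d2 by (simp add: algebra_simps power2_eq_square)
  also have "\<dots> = N - (norm a)\<^sup>2 * (b \<bullet> c)\<^sup>2 - (norm b)\<^sup>2 * (c \<bullet> a)\<^sup>2 - (norm c)\<^sup>2 * (a \<bullet> b)\<^sup>2
      + 2 * (b \<bullet> c) * (c \<bullet> a) * (a \<bullet> b)"
    unfolding N_def norms dot ..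
  also have "\<dots> / N = 1 - (cos (vec_angle b c))\<^sup>2 - (cos (vec_angle c a))\<^sup>2 - (cos (vec_angle a b))\<^sup>2
      + 2 * cos (vec_angle b c) * cos (vec_angle c a) * cos (vec_angle a b)"
    unfolding N_def cos_vec_angle using nz' by (simp add: field_simps power2_eq_square)
  finally have eq: "d * (sin (vec_angle b c) * sin (vec_angle c a) * sin (vec_angle a b)) = \<dots>" .
  \<comment> \<open>Passing to the supplementary angles keeps the sines and reverses all three
    cosines, hence the sign of the triple product.\<close>
  have "d \<le> 2 * vol_bound ((pi - vec_angle b c) / 2) ((pi - (pi - vec_angle c a) - (pi - vec_angle a b)) / 2)"
    by (rule triangle_det_le_vol_bound) (use bounds d eq in auto)
  then show "v \<bullet> (w \<times> u) \<le> 2 * vol_bound ((pi - vec_angle b c) / 2) ((vec_angle c a + vec_angle a b - pi) / 2)"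
    by (simp add: d_def algebra_simps)
qed

section \<open>Facets at a vertex\<close>

text \<open>Cramer's rule with the denominator cleared. When the determinant is positive, the inner
  products with the side normals have the signs of the coordinates in the basis v, w, u.\<close>

lemma cross3_coordinates:
  fixes u v w y :: "real^3"
  shows "(v \<bullet> (w \<times> u)) *\<^sub>R y = ((w \<times> u) \<bullet> y) *\<^sub>R v + ((u \<times> v) \<bullet> y) *\<^sub>R w + ((v \<times> w) \<bullet> y) *\<^sub>R u"
  unfolding vec_eq_iff forall_3
  by (simp add: inner_vec_def sum_3 cross_components algebra_simps)

lemma measure_tetrahedron:
  fixes u v w :: "real^3"
  shows "measure lebesgue (convex hull {0, v, w, u}) = \<bar>v \<bullet> (w \<times> u)\<bar> / 6"
proof -
  define g where "g x = x$1 *\<^sub>R v + x$2 *\<^sub>R w + x$3 *\<^sub>R u" for x :: "real^3"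
  define S :: "(real^3) set" where "S = convex hull (insert 0 Basis)"
  have lin: "linear g" by (rule linearI) (simp_all add: g_def algebra_simps)
  have "compact S" unfolding S_def by (intro finite_imp_compact_convex_hull) auto
  then have S: "bounded S" "S \<in> sets lebesgue" "S \<in> sets borel"
    by (auto intro: compact_imp_bounded fmeasurableD lmeasurable_compact borel_compact)
  have B: "Basis = {axis 1 1, axis 2 1, axis 3 1 :: real^3}"
    by (auto simp: Basis_vec_def UNIV_3)
  have "g ` insert 0 Basis = {0, v, w, u}"
    unfolding B image_insert image_empty by (simp add: g_def axis_def)
  then have "convex hull {0, v, w, u} = g ` S"
    unfolding S_def using convex_hull_linear_image[OF lin, of "insert 0 Basis"] by simp
  moreover have "det (matrix g) = v \<bullet> (w \<times> u)"
    by (simp add: det_3 matrix_def g_def axis_def cross3_simps)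
  moreover have "measure lebesgue S = 1 / 6"
    using S content_std_simplex[where 'a = "real^3"] by (simp add: S_def fact_numeral)
  ultimately show ?thesis using measure_lebesgue_linear_transformation[OF S(1,2) lin] by simp
qed

text \<open>Both sides are the part in the unit ball of the cone spanned by v, w, u; a nonzero point
  of the cone meets the triangle after division by its coordinate sum.\<close>

lemma solid_sector_triangle:
  fixes u v w :: "real^3"
  assumes D: "0 < v \<bullet> (w \<times> u)"
  shows "solid_sector (radial_projection ` (convex hull {v, w, u})) =
    {x \<in> cball 0 1. 0 \<le> (w \<times> u) \<bullet> x \<and> 0 \<le> (u \<times> v) \<bullet> x \<and> 0 \<le> (v \<times> w) \<bullet> x}"
    (is "?L = ?R")
proof (intro equalityI subsetI)
  define d where "d = v \<bullet> (w \<times> u)"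
  have dots: "(w \<times> u) \<bullet> v = d" "(u \<times> v) \<bullet> w = d" "(v \<times> w) \<bullet> u = d"
    unfolding d_def by (metis cross_triple inner_commute)+
  have d: "0 < d" using D by (simp add: d_def)
  fix x assume "x \<in> ?L"
  then obtain t y where x: "x = t *\<^sub>R (y /\<^sub>R norm y)" and t: "0 \<le> t" "t \<le> 1"
    and "y \<in> convex hull {v, w, u}"
    by (auto simp: solid_sector_def radial_projection_def)
  then obtain \<alpha> \<beta> \<gamma> where y: "y = \<alpha> *\<^sub>R v + \<beta> *\<^sub>R w + \<gamma> *\<^sub>R u" and pos: "0 \<le> \<alpha>" "0 \<le> \<beta>" "0 \<le> \<gamma>"
    by (auto simp: convex_hull_3)
  have "(w \<times> u) \<bullet> y = \<alpha> * d" "(u \<times> v) \<bullet> y = \<beta> * d" "(v \<times> w) \<bullet> y = \<gamma> * d"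
    by (simp_all add: y inner_add_right dots dot_cross_self)
  moreover have "norm x \<le> 1" using t by (cases "y = 0") (simp_all add: x mult.assoc)
  ultimately show "x \<in> ?R" using pos d t by (simp add: x)
next
  define d where "d = v \<bullet> (w \<times> u)"
  have d: "0 < d" using D by (simp add: d_def)
  fix x assume x: "x \<in> ?R"
  show "x \<in> ?L"
  proof (cases "x = 0")
    case True
    have "v \<in> convex hull {v, w, u}" by (simp add: hull_inc)
    moreover have "x = 0 *\<^sub>R radial_projection v" using True by simp
    ultimately show ?thesis unfolding solid_sector_def mem_Collect_eq
      by (intro exI[of _ 0] exI[of _ "radial_projection v"]) simp
  next
    case False
    define \<alpha> \<beta> \<gamma> where "\<alpha> = ((w \<times> u) \<bullet> x) / d" and "\<beta> = ((u \<times> v) \<bullet> x) / d" and "\<gamma> = ((v \<times> w) \<bullet> x) / d"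
    have pos: "0 \<le> \<alpha>" "0 \<le> \<beta>" "0 \<le> \<gamma>" using x d by (simp_all add: \<alpha>_def \<beta>_def \<gamma>_def)
    have "x = (1 / d) *\<^sub>R (d *\<^sub>R x)" using d by simp
    also have "d *\<^sub>R x = ((w \<times> u) \<bullet> x) *\<^sub>R v + ((u \<times> v) \<bullet> x) *\<^sub>R w + ((v \<times> w) \<bullet> x) *\<^sub>R u"
      unfolding d_def by (rule cross3_coordinates)
    finally have xc: "x = \<alpha> *\<^sub>R v + \<beta> *\<^sub>R w + \<gamma> *\<^sub>R u"
      by (simp add: \<alpha>_def \<beta>_def \<gamma>_def scaleR_add_right)
    define s where "s = \<alpha> + \<beta> + \<gamma>"
    have "s \<noteq> 0"
    proof
      assume "s = 0"
      then have "\<alpha> = 0" "\<beta> = 0" "\<gamma> = 0" using pos by (auto simp: s_def)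
      then show False using xc False by simp
    qed
    then have s: "0 < s" using pos by (simp add: s_def)
    have "x /\<^sub>R s = (\<alpha> / s) *\<^sub>R v + (\<beta> / s) *\<^sub>R w + (\<gamma> / s) *\<^sub>R u"
      by (subst xc) (simp add: scaleR_add_right divide_inverse mult.commute)
    moreover have "\<alpha> / s + \<beta> / s + \<gamma> / s = 1" using s by (simp add: s_def flip: add_divide_distrib)
    ultimately have hull: "x /\<^sub>R s \<in> convex hull {v, w, u}"
      unfolding convex_hull_3 mem_Collect_eq using pos s
      by (intro exI[of _ "\<alpha> / s"] exI[of _ "\<beta> / s"] exI[of _ "\<gamma> / s"]) simp
    have "x = norm x *\<^sub>R radial_projection (x /\<^sub>R s)"
      using s False by (simp add: radial_projection_def field_simps)
    then show ?thesis using hull x unfolding solid_sector_def by fastforce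
  qed
qed

text \<open>The cone over \<open>G\<close> fattened by the whole line through \<open>v\<close>. The
  strict inequality matters: for \<open>v\<close> in \<open>G\<close>, the choice e = 0 and s = 1
  would admit every point. The form makes sense for any facet, so the tiling can be proved by
  convexity alone.\<close>

definition vertex_wedge :: "'a::real_vector \<Rightarrow> 'a set \<Rightarrow> 'a set" where
  "vertex_wedge v G = {y. \<exists>e>0. \<exists>s. e *\<^sub>R y + s *\<^sub>R v \<in> G}"

text \<open>The shift along v leaves the coordinate of v free, so only the sign conditions for w and
  u survive.\<close>

lemma vertex_wedge_triangle:
  fixes u v w :: "real^3"
  assumes D: "0 < v \<bullet> (w \<times> u)"
  shows "vertex_wedge v (convex hull {v, w, u}) = {y. 0 \<le> (u \<times> v) \<bullet> y \<and> 0 \<le> (v \<times> w) \<bullet> y}"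
    (is "?L = ?R")
proof (intro equalityI subsetI)
  define d where "d = v \<bullet> (w \<times> u)"
  have dots: "(w \<times> u) \<bullet> v = d" "(u \<times> v) \<bullet> w = d" "(v \<times> w) \<bullet> u = d"
    unfolding d_def by (metis cross_triple inner_commute)+
  have d: "0 < d" using D by (simp add: d_def)
  fix y assume "y \<in> ?L"
  then obtain e s \<alpha> \<beta> \<gamma> where e: "0 < e" and y: "e *\<^sub>R y + s *\<^sub>R v = \<alpha> *\<^sub>R v + \<beta> *\<^sub>R w + \<gamma> *\<^sub>R u"
    and pos: "0 \<le> \<beta>" "0 \<le> \<gamma>"
    by (auto simp: vertex_wedge_def convex_hull_3)
  have "e * ((u \<times> v) \<bullet> y) = (u \<times> v) \<bullet> (e *\<^sub>R y + s *\<^sub>R v)"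
    "e * ((v \<times> w) \<bullet> y) = (v \<times> w) \<bullet> (e *\<^sub>R y + s *\<^sub>R v)"
    by (simp_all add: inner_add_right dot_cross_self)
  then have "e * ((u \<times> v) \<bullet> y) = \<beta> * d" "e * ((v \<times> w) \<bullet> y) = \<gamma> * d"
    unfolding y by (simp_all add: inner_add_right dots dot_cross_self)
  then have "0 \<le> e * ((u \<times> v) \<bullet> y)" "0 \<le> e * ((v \<times> w) \<bullet> y)" using pos d by simp_all
  then show "y \<in> ?R" using e by (simp add: zero_le_mult_iff)
next
  define d where "d = v \<bullet> (w \<times> u)"
  have d: "0 < d" using D by (simp add: d_def)
  fix y assume y: "y \<in> ?R"
  define \<alpha> \<beta> \<gamma> where "\<alpha> = ((w \<times> u) \<bullet> y) / d" and "\<beta> = ((u \<times> v) \<bullet> y) / d" and "\<gamma> = ((v \<times> w) \<bullet> y) / d"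
  have pos: "0 \<le> \<beta>" "0 \<le> \<gamma>" using y d by (simp_all add: \<beta>_def \<gamma>_def)
  have "y = (1 / d) *\<^sub>R (d *\<^sub>R y)" using d by simp
  also have "d *\<^sub>R y = ((w \<times> u) \<bullet> y) *\<^sub>R v + ((u \<times> v) \<bullet> y) *\<^sub>R w + ((v \<times> w) \<bullet> y) *\<^sub>R u"
    unfolding d_def by (rule cross3_coordinates)
  finally have yc: "y = \<alpha> *\<^sub>R v + \<beta> *\<^sub>R w + \<gamma> *\<^sub>R u"
    by (simp add: \<alpha>_def \<beta>_def \<gamma>_def scaleR_add_right)
  \<comment> \<open>With this e the numbers e, e * \<beta>, e * \<gamma> are barycentric
    coordinates; the shift replaces the coefficient e * \<alpha> of v by e.\<close>
  define e where "e = 1 / (1 + \<beta> + \<gamma>)"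
  have e: "0 < e" using pos by (simp add: e_def add_pos_nonneg)
  have sum: "1 - e * \<beta> - e * \<gamma> = e" using pos by (simp add: e_def divide_simps)
  have "e *\<^sub>R y + (e - e * \<alpha>) *\<^sub>R v = e *\<^sub>R v + (e * \<beta>) *\<^sub>R w + (e * \<gamma>) *\<^sub>R u"
    by (subst yc) (simp add: algebra_simps)
  moreover have "e + e * \<beta> + e * \<gamma> = 1" using sum by simp
  ultimately have "e *\<^sub>R y + (e - e * \<alpha>) *\<^sub>R v \<in> convex hull {v, w, u}"
    unfolding convex_hull_3 mem_Collect_eq using pos e
    by (intro exI[of _ e] exI[of _ "e * \<beta>"] exI[of _ "e * \<gamma>"]) simp
  then show "y \<in> ?L" using e by (auto simp: vertex_wedge_def)
qed

section \<open>Tiling of space by the wedges at a vertex\<close>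

lemma facet_unit_normal:
  fixes P :: "'a::euclidean_space set"
  assumes "polytope P" "0 \<in> interior P" "G facet_of P"
  obtains a where "P \<subseteq> {x. a \<bullet> x \<le> 1}" "G = P \<inter> {x. a \<bullet> x = 1}"
proof -
  obtain a b where a: "a \<noteq> 0" and P: "P \<subseteq> {x. a \<bullet> x \<le> b}" and G: "G = P \<inter> {x. a \<bullet> x = b}"
    using facet_of_polyhedron[OF polytope_imp_polyhedron[OF assms(1)] assms(3)] by metis
  have "interior P \<subseteq> {x. a \<bullet> x < b}"
    using interior_mono[OF P] interior_halfspace_le[OF a] by simp
  then have "0 < b" using assms(2) by auto
  then have "a \<bullet> x \<le> b \<longleftrightarrow> (a /\<^sub>R b) \<bullet> x \<le> 1" "a \<bullet> x = b \<longleftrightarrow> (a /\<^sub>R b) \<bullet> x = 1" for x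
    by (auto simp: field_simps)
  then show ?thesis using that[of "a /\<^sub>R b"] P G by auto
qed

text \<open>The normalized functionals of both facets equal 1 at v, so their difference ignores the
  shift along v. It is nonnegative on one wedge and nonpositive on the other, which confines the
  overlap to a plane.\<close>

lemma negligible_vertex_wedge_Int:
  fixes P :: "'a::euclidean_space set"
  assumes P: "polytope P" "0 \<in> interior P"
    and G: "G facet_of P" "v \<in> G" and H: "H facet_of P" "v \<in> H" and "G \<noteq> H"
  shows "negligible (vertex_wedge v G \<inter> vertex_wedge v H)"
proof -
  obtain a where a: "P \<subseteq> {x. a \<bullet> x \<le> 1}" "G = P \<inter> {x. a \<bullet> x = 1}"
    using facet_unit_normal[OF P G(1)] .
  obtain b where b: "P \<subseteq> {x. b \<bullet> x \<le> 1}" "H = P \<inter> {x. b \<bullet> x = 1}"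
    using facet_unit_normal[OF P H(1)] .
  have av: "a \<bullet> v = 1" "b \<bullet> v = 1" using G H a b by auto
  have le: "b' \<bullet> y \<le> a' \<bullet> y"
    if y: "y \<in> vertex_wedge v (P \<inter> {x. a' \<bullet> x = 1})" and b': "P \<subseteq> {x. b' \<bullet> x \<le> 1}"
      and v1: "a' \<bullet> v = 1" "b' \<bullet> v = 1" for a' b' y
  proof -
    obtain e s where e: "0 < e" "e *\<^sub>R y + s *\<^sub>R v \<in> P" "a' \<bullet> (e *\<^sub>R y + s *\<^sub>R v) = 1"
      using y by (auto simp: vertex_wedge_def)
    then have "b' \<bullet> (e *\<^sub>R y + s *\<^sub>R v) \<le> 1" using b' by auto
    then have "e * (b' \<bullet> y) \<le> e * (a' \<bullet> y)" using e(3) v1 by (simp add: inner_add_right)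
    then show ?thesis using e(1) by simp
  qed
  have "vertex_wedge v G \<inter> vertex_wedge v H \<subseteq> {y. (a - b) \<bullet> y = 0}"
    using le[of _ a b] le[of _ b a] a b av by (force simp: inner_diff_left intro: antisym)
  moreover have "a - b \<noteq> 0" using a b \<open>G \<noteq> H\<close> by auto
  ultimately show ?thesis using negligible_hyperplane[of "a - b" 0] negligible_subset by blast
qed

text \<open>For small \<open>e\<close>, the segment from \<open>e y + (1 - \<eta>) v\<close> to \<open>e y + (1 + \<eta>) v\<close> leaves the polytope
  at a point so close to \<open>v\<close> that only facets through \<open>v\<close> can contain it.\<close>

lemma Union_vertex_wedge:
  fixes P :: "'a::euclidean_space set"
  assumes P: "polytope P" "0 \<in> interior P" and v: "v extreme_point_of P"
  shows "(\<Union>G\<in>{G. G facet_of P \<and> v \<in> G}. vertex_wedge v G) = UNIV"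
proof (intro equalityI subset_UNIV subsetI)
  fix y :: 'a
  have con: "convex P" and cl: "closed P"
    using P polytope_imp_convex polytope_imp_closed by auto
  have vP: "v \<in> P" using v by (simp add: extreme_point_of_def)
  have vint: "v \<notin> interior P" using v extreme_point_not_in_interior by blast
  then have v0: "v \<noteq> 0" using P(2) by auto
  have "affine hull P = UNIV"
    using P(2) by (metis affine_hull_nonempty_interior empty_iff)
  then have fr: "frontier P = \<Union>{G. G facet_of P}"
    using rel_frontier_of_polyhedron[OF polytope_imp_polyhedron[OF P(1)]] rel_frontier_frontier by metis
  define K where "K = \<Union>{G. G facet_of P \<and> v \<notin> G}"
  have "finite {G. G facet_of P}" by (rule finite_polytope_facets[OF P(1)])
  then have "finite {G. G facet_of P \<and> v \<notin> G}" by (rule rev_finite_subset) auto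
  moreover have "closed G" if "G facet_of P" for G
    using that P(1) facet_of_imp_face_of face_of_polytope_polytope polytope_imp_closed by blast
  ultimately have "closed K" unfolding K_def by (intro closed_Union) auto
  moreover have "v \<notin> K" by (auto simp: K_def)
  ultimately obtain \<delta> where \<delta>: "0 < \<delta>" "ball v \<delta> \<inter> K = {}"
    by (metis open_Compl open_contains_ball ComplI Compl_iff disjoint_eq_subset_Compl)
  \<comment> \<open>Half of \<delta> is kept for the displacement along v and the other half for e
    y.\<close>
  define \<eta> where "\<eta> = min (1/2) (\<delta> / (2 * norm v))"
  have \<eta>: "0 < \<eta>" "\<eta> < 1" "\<eta> * norm v \<le> \<delta> / 2"
  proof -
    show "0 < \<eta>" "\<eta> < 1" using \<delta> v0 by (auto simp: \<eta>_def)
    have "\<eta> * norm v \<le> \<delta> / (2 * norm v) * norm v" by (intro mult_right_mono) (auto simp: \<eta>_def)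
    then show "\<eta> * norm v \<le> \<delta> / 2" using v0 by simp
  qed
  have in1: "(1 - \<eta>) *\<^sub>R v \<in> interior P"
    using mem_interior_convex_shrink[OF con P(2) vP, of \<eta>] \<eta> by (simp add: algebra_simps)
  have out1: "(1 + \<eta>) *\<^sub>R v \<notin> P"
  proof
    assume "(1 + \<eta>) *\<^sub>R v \<in> P"
    then have "(1 + \<eta>) *\<^sub>R v - (\<eta> / (1 + \<eta>)) *\<^sub>R ((1 + \<eta>) *\<^sub>R v - 0) \<in> interior P"
      using mem_interior_convex_shrink[OF con P(2), of "(1 + \<eta>) *\<^sub>R v" "\<eta> / (1 + \<eta>)"] \<eta> by simp
    moreover have "(1 + \<eta>) *\<^sub>R v - (\<eta> / (1 + \<eta>)) *\<^sub>R ((1 + \<eta>) *\<^sub>R v - 0) = v"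
    proof -
      have "(1 + \<eta>) *\<^sub>R v - (\<eta> / (1 + \<eta>)) *\<^sub>R ((1 + \<eta>) *\<^sub>R v - 0) = (1 + \<eta> - \<eta> / (1 + \<eta>) * (1 + \<eta>)) *\<^sub>R v"
        by (simp only: scaleR_diff_left diff_0_right scaleR_scaleR)
      then show ?thesis using \<eta> by simp
    qed
    ultimately show False using vint by simp
  qed
  have lim: "((\<lambda>e. e *\<^sub>R y + c) \<longlongrightarrow> c) (at_right 0)" for c
    by (rule tendsto_eq_intros refl | simp)+
  have "\<forall>\<^sub>F e in at_right 0. e *\<^sub>R y + (1 - \<eta>) *\<^sub>R v \<in> interior P"
    using topological_tendstoD[OF lim open_interior in1] .
  moreover have "\<forall>\<^sub>F e in at_right 0. e *\<^sub>R y + (1 + \<eta>) *\<^sub>R v \<in> - P"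
    using topological_tendstoD[OF lim open_Compl[OF cl]] out1 by simp
  moreover have "\<forall>\<^sub>F e in at_right 0. norm (e *\<^sub>R y + 0) < \<delta> / 2"
    using order_tendstoD(2)[OF tendsto_norm[OF lim[of 0]], of "\<delta> / 2"] \<delta> by simp
  moreover have "\<forall>\<^sub>F e in at_right 0. (0::real) < e" by (rule eventually_at_right_less)
  ultimately have "\<forall>\<^sub>F e in at_right (0::real). 0 < e \<and> e *\<^sub>R y + (1 - \<eta>) *\<^sub>R v \<in> interior P \<and>
      e *\<^sub>R y + (1 + \<eta>) *\<^sub>R v \<notin> P \<and> norm (e *\<^sub>R y) < \<delta> / 2"
    by eventually_elim simp
  then obtain e where e: "0 < e" "e *\<^sub>R y + (1 - \<eta>) *\<^sub>R v \<in> interior P"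
    "e *\<^sub>R y + (1 + \<eta>) *\<^sub>R v \<notin> P" "norm (e *\<^sub>R y) < \<delta> / 2"
    using eventually_happens'[OF trivial_limit_at_right_real] by blast
  define I where "I = (\<lambda>s. e *\<^sub>R y + s *\<^sub>R v) ` {1 - \<eta>..1 + \<eta>}"
  have "connected I"
    unfolding I_def by (intro connected_continuous_image continuous_intros) simp
  have "e *\<^sub>R y + (1 - \<eta>) *\<^sub>R v \<in> I" "e *\<^sub>R y + (1 + \<eta>) *\<^sub>R v \<in> I"
    unfolding I_def by (rule imageI, use \<eta> in simp)+
  then have "I \<inter> P \<noteq> {}" "I - P \<noteq> {}" using e(2,3) interior_subset by blast+
  with \<open>connected I\<close> have "I \<inter> frontier P \<noteq> {}" by (simp add: connected_Int_frontier)
  then obtain s where s: "1 - \<eta> \<le> s" "s \<le> 1 + \<eta>" "e *\<^sub>R y + s *\<^sub>R v \<in> frontier P"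
    by (auto simp: I_def)
  have "dist v (e *\<^sub>R y + s *\<^sub>R v) = norm (e *\<^sub>R y + (s - 1) *\<^sub>R v)"
    unfolding dist_commute[of v] by (simp add: dist_norm algebra_simps)
  also have "\<dots> \<le> norm (e *\<^sub>R y) + \<bar>s - 1\<bar> * norm v"
    using norm_triangle_ineq[of "e *\<^sub>R y" "(s - 1) *\<^sub>R v"] by simp
  also have "\<bar>s - 1\<bar> * norm v \<le> \<eta> * norm v" using s by (intro mult_right_mono) auto
  finally have "e *\<^sub>R y + s *\<^sub>R v \<in> ball v \<delta>" using e(4) \<eta>(3) by simp
  then have "e *\<^sub>R y + s *\<^sub>R v \<notin> K" using \<delta>(2) by blast
  then obtain G where "G facet_of P" "v \<in> G" "e *\<^sub>R y + s *\<^sub>R v \<in> G"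
    using s(3) unfolding fr K_def by blast
  then show "y \<in> (\<Union>G\<in>{G. G facet_of P \<and> v \<in> G}. vertex_wedge v G)"
    using e(1) by (auto simp: vertex_wedge_def)
qed

section \<open>From facets to pairs of angles, and summation\<close>

lemma simplicial_facet_triangle:
  fixes P :: "(real^3) set"
  assumes P: "simplicial_polytope P" "aff_dim P = 3" "inscribed_in_unit_sphere P" "0 \<in> interior P"
    and v: "v extreme_point_of P" and G: "G facet_of P" "v \<in> G"
  obtains w u where "norm v = 1" "norm w = 1" "norm u = 1" "0 < v \<bullet> (w \<times> u)" "G = convex hull {v, w, u}"
proof -
  have poly: "polytope P" using P(1) by (simp add: simplicial_polytope_def)
  have "2 simplex G" using P(1,2) G(1) by (auto simp: simplicial_polytope_def facet_of_def)
  then obtain C where C: "\<not> affine_dependent C" "card C = 3" "G = convex hull C"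
    by (auto simp: simplex_def)
  have face: "G face_of P" using G(1) by (rule facet_of_imp_face_of)
  have vC: "v \<in> C"
    using extreme_point_of_face[OF face, of v] v G(2) C(3) extreme_point_of_convex_hull by blast
  have unit: "norm x = 1" if "x \<in> C" for x
  proof -
    have "x extreme_point_of G"
      using that C extreme_point_of_convex_hull_affine_independent by blast
    then have "x extreme_point_of P" using extreme_point_of_face[OF face] by blast
    then show ?thesis using P(3) by (auto simp: inscribed_in_unit_sphere_def)
  qed
  have "card (C - {v}) = 2" using C(2) vC by simp
  then obtain w u where "C - {v} = {w, u}" by (auto simp: card_2_iff)
  then have Ceq: "C = {v, w, u}" using vC by blast
  obtain a where a: "G = P \<inter> {x. a \<bullet> x = 1}" using facet_unit_normal[OF poly P(4) G(1)] .
  \<comment> \<open>A vanishing determinant would put the vertices into a plane through the origin.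
    But the facet lies in a plane of value 1 for \<open>a\<close>, so the origin together with
    \<open>C\<close> has affine dimension 3.\<close>
  have "v \<bullet> (w \<times> u) \<noteq> 0"
  proof
    assume "v \<bullet> (w \<times> u) = 0"
    then have "det (vector [v, w, u] :: real^3^3) = 0" by (simp add: dot_cross_det)
    then have "\<not> invertible (vector [v, w, u] :: real^3^3)" using invertible_det_nz by blast
    then obtain n :: "real^3" where n: "n \<noteq> 0" "vector [v, w, u] *v n = (0 :: real^3)"
      unfolding invertible_left_inverse matrix_left_invertible_ker by blast
    have "(vector [v, w, u] *v n) $ i = (vector [v, w, u] :: real^3^3) $ i \<bullet> n" for i
      by (simp add: matrix_vector_mult_def inner_vec_def)
    then have "(vector [v, w, u] :: real^3^3) $ i \<bullet> n = 0" for i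
      using n(2) by (metis zero_index)
    from this[of 1] this[of 2] this[of 3] have "v \<bullet> n = 0" "w \<bullet> n = 0" "u \<bullet> n = 0"
      by (simp_all add: vector_3)
    then have sub: "insert 0 C \<subseteq> {x. n \<bullet> x = 0}" by (simp add: Ceq inner_commute)
    have "C \<subseteq> {x. a \<bullet> x = 1}" using a C(3) hull_subset[of C convex] by blast
    then have "affine hull C \<subseteq> {x. a \<bullet> x = 1}" by (simp add: hull_minimal affine_hyperplane)
    then have "0 \<notin> affine hull C" by auto
    then have "aff_dim (insert 0 C) = 3"
      using aff_dim_insert[of 0 C] aff_dim_affine_independent[OF C(1)] C(2) by simp
    then show False using aff_dim_subset[OF sub] n(1) by simp
  qed
  \<comment> \<open>Swapping the two other vertices reverses the sign, so the orientation can be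
    chosen.\<close>
  then consider "0 < v \<bullet> (w \<times> u)" | "0 < v \<bullet> (u \<times> w)"
    by (metis cross_skew inner_minus_right neg_0_less_iff_less linorder_neqE_linordered_idom)
  then show ?thesis
    using that[of w u] that[of u w] unit C(3) by cases (auto simp: Ceq insert_commute)
qed

text \<open>The wedge volume depends on h alone and the area on h - x, so summing these two over the
  facets determines the means of both coordinates.\<close>

lemma facet_estimate:
  fixes P :: "(real^3) set"
  assumes P: "simplicial_polytope P" "aff_dim P = 3" "inscribed_in_unit_sphere P" "0 \<in> interior P"
    and v: "v extreme_point_of P" and G: "G facet_of P" "v \<in> G"
  shows "vertex_wedge v G \<inter> cball 0 1 \<in> lmeasurable \<and>
    (\<exists>z. z \<in> angle_domain \<and>
      measure lebesgue (vertex_wedge v G \<inter> cball 0 1) = 4 / 3 * fst z \<and>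
      sphere_area (radial_projection ` G) = 2 * fst z - 2 * snd z \<and>
      measure lebesgue (facial_cone G) \<le> (case z of (h, x) \<Rightarrow> vol_bound h x) / 3)"
proof -
  obtain w u where unit: "norm v = 1" "norm w = 1" "norm u = 1"
    and D: "0 < v \<bullet> (w \<times> u)" and Geq: "G = convex hull {v, w, u}"
    using simplicial_facet_triangle[OF P v G] .
  define a b c where "a = w \<times> u" and "b = u \<times> v" and "c = v \<times> w"
  note bound = det_le_vol_bound[OF unit D, folded a_def b_def c_def]
  have nz: "a \<noteq> 0" "b \<noteq> 0" "c \<noteq> 0"
    using D unfolding a_def b_def c_def by (metis cross_triple inner_commute inner_zero_right less_irrefl)+
  have wedge: "vertex_wedge v G \<inter> cball 0 1 = {x \<in> cball 0 1. 0 \<le> b \<bullet> x \<and> 0 \<le> c \<bullet> x}"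
    unfolding Geq vertex_wedge_triangle[OF D] a_def b_def c_def by auto
  define h x where "h = (pi - vec_angle b c) / 2" and "x = (vec_angle c a + vec_angle a b - pi) / 2"
  have "measure lebesgue (vertex_wedge v G \<inter> cball 0 1) = 4 / 3 * h"
    unfolding wedge measure_wedge[OF nz(2,3)] by (simp add: h_def)
  moreover have "sphere_area (radial_projection ` G) = 2 * h - 2 * x"
    using girard[OF nz]
    unfolding sphere_area_def Geq solid_sector_triangle[OF D, folded a_def b_def c_def]
    by (simp add: h_def x_def field_simps)
  moreover have "measure lebesgue (facial_cone G) \<le> vol_bound h x / 3"
  proof -
    have "facial_cone G = convex hull {0, v, w, u}"
      unfolding facial_cone_def Geq by (simp flip: hull_insert)
    then show ?thesis
      using measure_tetrahedron[of v w u] bound(1) D by (simp add: a_def h_def x_def)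
  qed
  moreover have "(h, x) \<in> angle_domain"
    using bound(2-7) by (auto simp: angle_domain_def h_def x_def)
  moreover have "vertex_wedge v G \<inter> cball 0 1 \<in> lmeasurable"
    unfolding wedge by (rule lmeasurable_cball_Int_halfspaces)
  ultimately show ?thesis by (intro conjI exI[of _ "(h, x)"]) simp_all
qed

theorem lemma4p3:
  fixes P :: "(real^3) set" and v :: "real^3" and m :: nat
    and F :: "nat \<Rightarrow> (real^3) set" and \<alpha>\<^sub>v :: real
  assumes "simplicial_polytope P"
    and "aff_dim P = 3"
    and "inscribed_in_unit_sphere P"
    and "0 \<in> interior P"
    and "v extreme_point_of P"
    and "m = vertex_degree P v"
    and "cyclic_facets_at P v m F"
    and "\<alpha>\<^sub>v = (\<Sum>i=1..m. sphere_area (radial_projection ` F i))"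
  shows "(\<Sum>i=1..m. measure lebesgue (facial_cone (F i))) \<le> Psi m \<alpha>\<^sub>v"
proof -
  define V where "V = (\<lambda>(h, x). vol_bound h x)"
  have poly: "polytope P" using assms(1) by (simp add: simplicial_polytope_def)
  have bij: "bij_betw F {1..m} {G. G facet_of P \<and> v \<in> G}"
    using assms(7) by (simp add: cyclic_facets_at_def)
  then have facet: "F i facet_of P" "v \<in> F i" if "i \<in> {1..m}" for i
    using that bij_betwE by fastforce+
  note est = facet_estimate[OF assms(1-5) facet, folded V_def]
  have "\<forall>i\<in>{1..m}. \<exists>z. z \<in> angle_domain \<and>
      measure lebesgue (vertex_wedge v (F i) \<inter> cball 0 1) = 4 / 3 * fst z \<and>
      sphere_area (radial_projection ` F i) = 2 * fst z - 2 * snd z \<and>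
      measure lebesgue (facial_cone (F i)) \<le> V z / 3"
    using est unfolding V_def by blast
  then obtain z where z: "\<And>i. i \<in> {1..m} \<Longrightarrow> z i \<in> angle_domain"
    and wedge: "\<And>i. i \<in> {1..m} \<Longrightarrow> measure lebesgue (vertex_wedge v (F i) \<inter> cball 0 1) = 4 / 3 * fst (z i)"
    and area: "\<And>i. i \<in> {1..m} \<Longrightarrow> sphere_area (radial_projection ` F i) = 2 * fst (z i) - 2 * snd (z i)"
    and vol: "\<And>i. i \<in> {1..m} \<Longrightarrow> measure lebesgue (facial_cone (F i)) \<le> V (z i) / 3"
    by metis
  define W where "W i = vertex_wedge v (F i) \<inter> cball 0 1" for i
  have "(\<Union>i\<in>{1..m}. vertex_wedge v (F i)) = (\<Union>G\<in>F ` {1..m}. vertex_wedge v G)" by blast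
  also have "\<dots> = UNIV"
    unfolding bij_betw_imp_surj_on[OF bij] by (rule Union_vertex_wedge[OF poly assms(4,5)])
  finally have "\<Union>(W ` {1..m}) = cball 0 1" unfolding W_def by blast
  moreover have "measure lebesgue (\<Union>(W ` {1..m})) = (\<Sum>i\<in>{1..m}. measure lebesgue (W i))"
  proof (rule measure_negligible_finite_Union_image)
    show "pairwise (\<lambda>i j. negligible (W i \<inter> W j)) {1..m}"
    proof (rule pairwiseI)
      fix i j assume ij: "i \<in> {1..m}" "j \<in> {1..m}" "i \<noteq> j"
      then have "F i \<noteq> F j" using bij by (meson bij_betw_def inj_onD)
      then have "negligible (vertex_wedge v (F i) \<inter> vertex_wedge v (F j))"
        using negligible_vertex_wedge_Int[OF poly assms(4)] facet ij by blast
      then show "negligible (W i \<inter> W j)"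
        unfolding W_def by (rule negligible_subset) blast
    qed
    show "W i \<in> lmeasurable" if "i \<in> {1..m}" for i using est[OF that that] by (simp add: W_def)
  qed simp
  moreover have "measure lebesgue (cball (0::real^3) 1) = 4 * pi / 3"
    by (simp add: content_cball unit_ball_vol_3)
  \<comment> \<open>The wedges overlap in null sets only, so their volumes add up to that of the
    unit ball.\<close>
  ultimately have "4 / 3 * (\<Sum>i=1..m. fst (z i)) = 4 * pi / 3"
    using wedge by (simp add: sum_distrib_left W_def)
  then have sum_h: "(\<Sum>i=1..m. fst (z i)) = pi" by simp
  \<comment> \<open>For m = 0 the sum would be 0 and not pi.\<close>
  then have m: "0 < m" by (cases "m = 0") auto
  have "\<alpha>\<^sub>v = (\<Sum>i=1..m. 2 * fst (z i) - 2 * snd (z i))"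
    unfolding assms(8) by (rule sum.cong[OF refl area])
  also have "\<dots> = 2 * pi - 2 * (\<Sum>i=1..m. snd (z i))"
    unfolding sum_subtractf sum_distrib_left[symmetric] sum_h ..
  finally have "\<alpha>\<^sub>v = 2 * pi - 2 * (\<Sum>i=1..m. snd (z i))" .
  then have sum_x: "(\<Sum>i=1..m. snd (z i)) = (2 * pi - \<alpha>\<^sub>v) / 2" by simp
  define zm where "zm = (\<Sum>i=1..m. (1 / real m) *\<^sub>R z i)"
  have "(\<Sum>i=1..m. z i) = (pi, (2 * pi - \<alpha>\<^sub>v) / 2)"
    by (simp only: prod_eq_iff fst_sum snd_sum sum_h sum_x fst_conv snd_conv)
  then have zm: "zm = (pi / m, (2 * pi - \<alpha>\<^sub>v) / (2 * m))"
    unfolding zm_def scaleR_sum_right[symmetric] by simp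
  have conv: "convex_on angle_domain (\<lambda>z. - V z)"
    using concave_vol_bound by (simp add: concave_on_def V_def case_prod_unfold)
  have "- V zm \<le> (\<Sum>i=1..m. (1 / real m) * - V (z i))"
    unfolding zm_def using m z by (intro convex_on_sum[OF _ _ conv]) auto
  then have "(\<Sum>i=1..m. V (z i)) / m \<le> V zm"
    by (simp add: sum_negf flip: sum_divide_distrib)
  then have jensen: "(\<Sum>i=1..m. V (z i)) \<le> m * V zm" using m by (simp add: field_simps)
  \<comment> \<open>Membership of the mean supplies the nonzero sine and cosine that
    \<open>vol_bound_alt\<close> asks for.\<close>
  have "zm \<in> angle_domain"
  proof -
    have "convex angle_domain" using conv convex_on_imp_convex by blast
    then show ?thesis unfolding zm_def using m z by (intro convex_sum) auto
  qed
  then have "sin (pi / m) \<noteq> 0" "cos ((2 * pi - \<alpha>\<^sub>v) / (2 * m)) \<noteq> 0"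
    using sin_gt_zero[of "pi / m"] cos_gt_zero_pi[of "(2 * pi - \<alpha>\<^sub>v) / (2 * m)"]
    by (auto simp: zm angle_domain_def)
  then have Psi: "Psi m \<alpha>\<^sub>v = m / 3 * V zm"
    by (simp add: Psi_def zm V_def vol_bound_alt)
  have "(\<Sum>i=1..m. measure lebesgue (facial_cone (F i))) \<le> (\<Sum>i=1..m. V (z i) / 3)"
    by (intro sum_mono vol)
  also have "\<dots> \<le> m / 3 * V zm" using jensen by (simp flip: sum_divide_distrib)
  finally show ?thesis unfolding Psi .
qed

end
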